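(* Let $\mathcal G=\mathcal T$ or $\mathcal G=\mathcal T_o$, and let $p\in(2,6)$. The function $\mathcal L_{\mathcal G}:[0,\infty)\to\mathbb R$ is concave, satisfies $\mathcal L_{\mathcal G}(0)=0$ and $$\mathcal L_{\mathcal G}(\mu)\le \tfrac12\lambda_1\mu\qquad\forall \mu\ge 0,$$ and is (right-)differentiable at $\mu=0^+$ with $$\mathcal L_{\mathcal G}'(0^+)=\frac{\lambda_1}{2}>0,$$ so that $\mathcal L_{\mathcal G}(\mu)$ is strictly positive and increasing if $\mu>0$ is small enough. Moreover, as $\mu$ increases, $\mathcal L_{\mathcal G}$ achieves an absolute maximum, after which it becomes decreasing and eventually negative; that is, there is $\bar\mu>0$ with $\mathcal L_{\mathcal G}(\bar\mu)=\max_{\mu\ge0}\mathcal L_{\mathcal G}(\mu)$, such that $\mathcal L_{\mathcal G}$ is decreasing on $[\bar\mu,\infty)$, and $\mathcal L_{\mathcal G}(\mu)<0$ for all sufficiently large $\mu$.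
   Context: $\mathcal T$ (unrooted binary tree) is the infinite metric tree with all edges of length $1$ in which every vertex has degree $3$. $\mathcal T_o$ (rooted binary tree) is the infinite metric tree with all edges of length $1$ in which every vertex has degree $3$, except one vertex $o$ (the root), which has degree $1$. For $\mathcal G\in\{\mathcal T,\mathcal T_o\}$, $H^1(\mathcal G)$ is the space of continuous real-valued functions on $\mathcal G$ whose restriction to each edge is $H^1$ and such that $\int_{\mathcal G}(|u'|^2+|u|^2)\,dx<\infty$; all integrals and $L^p$ norms are with respect to the length measure. For $\mu\ge0$, $H^1_\mu(\mathcal G):=\{u\in H^1(\mathcal G):\int_{\mathcal G}|u|^2dx=\mu\}$. The NLS energy is $E(u,\mathcal G):=\frac12\int_{\mathcal G}|u'|^2dx-\frac1p\int_{\mathcal G}|u|^pdx$, and $\mathcal L_{\mathcal G}(\mu):=\inf_{u\in H^1_\mu(\mathcal G)}E(u,\mathcal G)$ for $\mu\ge0$. The constant $\lambda_1$ is $\lambda_1:=\inf_{0\not\equiv u\in H^1(\mathcal T)}\frac{\int_{\mathcal T}|u'|^2dx}{\int_{\mathcal T}|u|^2dx}=\inf_{0\not\equiv u\in H^1(\mathcal T_o)}\frac{\int_{\mathcal T_o}|u'|^2dx}{\int_{\mathcal T_o}|u|^2dx}>0$ (it is known that the two infima coincide and are positive). *)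

theory Defs
  imports "HOL-Analysis.Analysis"
begin

text \<open>
  A metric graph all of whose edges have length 1 is given by its combinatorial structure. Every edge
  e is a copy of the interval [0,1], with the endpoint 0 at tail e and the endpoint 1 at head e, and
  the pair (e, x) stands for the point of e with coordinate x.
\<close>

record ('v, 'e) unit_graph =
  verts :: "'v set"
  edges :: "'e set"
  tail :: "'e \<Rightarrow> 'v"
  head :: "'e \<Rightarrow> 'v"

definition points :: "('v, 'e) unit_graph \<Rightarrow> ('e \<times> real) set" where
  "points G = edges G \<times> {0..1}"

definition unit_interval :: "real measure" where
  "unit_interval = restrict_space lborel {0..1}"

definition length_measure :: "('v, 'e) unit_graph \<Rightarrow> ('e \<times> real) measure" where
  "length_measure G = count_space (edges G) \<Otimes>\<^sub>M unit_interval"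


subsection \<open>The binary trees\<close>

definition degree_in :: "('v, 'e) unit_graph \<Rightarrow> 'e set \<Rightarrow> 'v \<Rightarrow> nat" where
  "degree_in G F v = card {e \<in> F. tail G e = v} + card {e \<in> F. head G e = v}"

abbreviation vertex_degree :: "('v, 'e) unit_graph \<Rightarrow> 'v \<Rightarrow> nat" where
  "vertex_degree G \<equiv> degree_in G (edges G)"

text \<open>
  Absence of cycles is expressed by saying that every nonempty finite set of edges has a vertex of
  degree 1: a cycle is a finite set of edges without such a vertex, and conversely a nonempty finite
  set of edges without such a vertex contains a cycle.
\<close>

definition is_tree :: "('v, 'e) unit_graph \<Rightarrow> bool" where
  "is_tree G \<longleftrightarrow>
     verts G \<noteq> {} \<and> tail G ` edges G \<subseteq> verts G \<and> head G ` edges G \<subseteq> verts G \<and>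
     (\<forall>v \<in> verts G. \<forall>w \<in> verts G.
        (v, w) \<in> ({(tail G e, head G e) |e. e \<in> edges G} \<union> {(head G e, tail G e) |e. e \<in> edges G})\<^sup>*) \<and>
     (\<forall>F \<subseteq> edges G. finite F \<and> F \<noteq> {} \<longrightarrow> (\<exists>v \<in> verts G. degree_in G F v = 1))"

text \<open>
  The k branches at the vertex None (the root o, for k = 1) are indexed by i < k. The first edge of
  branch i is (i, []), the two edges following the edge (i, w) are (i, True # w) and (i, False # w),
  and the vertex where they meet the edge (i, w) is Some (i, w).
\<close>

fun parent :: "nat \<times> bool list \<Rightarrow> (nat \<times> bool list) option" where
  "parent (i, []) = None"
| "parent (i, b # w) = Some (i, w)"

type_synonym btree = "((nat \<times> bool list) option, nat \<times> bool list) unit_graph"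

definition branches :: "nat \<Rightarrow> btree" where
  "branches k =
     \<lparr> verts = insert None (Some ` ({..<k} \<times> UNIV)),
       edges = {..<k} \<times> UNIV,
       tail = parent,
       head = Some \<rparr>"

definition rooted_binary_tree :: btree where
  "rooted_binary_tree = branches 1"

definition unrooted_binary_tree :: btree where
  "unrooted_binary_tree = branches 3"

lemma parent_eq_None_iff: "parent e = None \<longleftrightarrow> snd e = []"
  by (cases e rule: parent.cases) auto

lemma parent_eq_Some_iff: "parent e = Some v \<longleftrightarrow> (\<exists>b. e = (fst v, b # snd v))"
  by (cases e rule: parent.cases; cases v) auto

lemma degree_branches_None: "vertex_degree (branches k) None = k"
proof -
  have "{e \<in> {..<k} \<times> UNIV. parent e = None} = {..<k} \<times> {[]}"
    by (auto simp: parent_eq_None_iff)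
  then show ?thesis
    by (simp add: degree_in_def branches_def)
qed

lemma degree_branches_Some:
  assumes "fst v < k"
  shows "vertex_degree (branches k) (Some v) = 3"
proof -
  have "{e \<in> {..<k} \<times> UNIV. parent e = Some v} = {(fst v, True # snd v), (fst v, False # snd v)}"
    using assms by (auto simp: parent_eq_Some_iff)
  moreover have "{e \<in> {..<k} \<times> UNIV. Some e = Some v} = {v}"
    using assms by (cases v) auto
  ultimately show ?thesis
    by (simp add: degree_in_def branches_def)
qed

lemma is_tree_branches: "is_tree (branches k)"
proof -
  let ?G = "branches k"
  let ?R = "{(tail ?G e, head ?G e) |e. e \<in> edges ?G} \<union> {(head ?G e, tail ?G e) |e. e \<in> edges ?G}"
  have to_root: "(v, None) \<in> ?R\<^sup>*" if "v \<in> verts ?G" for v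
  proof -
    have "(Some (i, w), None) \<in> ?R\<^sup>*" if "i < k" for i w
    proof (induction w)
      case Nil
      have "(Some (i, []), None) \<in> ?R"
        using that by (force simp: branches_def)
      then show ?case by (rule r_into_rtrancl)
    next
      case (Cons b w)
      have "(Some (i, b # w), Some (i, w)) \<in> ?R"
        using that by (force simp: branches_def)
      then show ?case using Cons by (rule converse_rtrancl_into_rtrancl)
    qed
    then show ?thesis
      using that by (auto simp: branches_def)
  qed
  have "sym ?R" by (auto simp: sym_def)
  then have "sym (?R\<^sup>*)" by (rule sym_rtrancl)
  then have connected: "(v, w) \<in> ?R\<^sup>*" if "v \<in> verts ?G" "w \<in> verts ?G" for v w
    using to_root[OF that(1)] to_root[OF that(2)] by (meson rtrancl_trans symD)
  have leaf: "\<exists>v \<in> verts ?G. degree_in ?G F v = 1"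
    if F: "F \<subseteq> edges ?G" "finite F" "F \<noteq> {}" for F
  proof -
    define m where "m = Max ((\<lambda>e. length (snd e)) ` F)"
    obtain e where e: "e \<in> F" "length (snd e) = m"
      unfolding m_def using Max_in[of "(\<lambda>e. length (snd e)) ` F"] F by fastforce
    have le: "length (snd e') \<le> m" if "e' \<in> F" for e'
      unfolding m_def using F that by (intro Max_ge) auto
    have "{e' \<in> F. parent e' = Some e} = {}"
      using le e by (fastforce simp: parent_eq_Some_iff)
    then have "card {e' \<in> F. parent e' = Some e} = 0"
      by (simp only: card.empty)
    moreover have "{e' \<in> F. Some e' = Some e} = {e}"
      using e by auto
    ultimately have "degree_in ?G F (Some e) = 1"
      by (simp add: degree_in_def branches_def)
    moreover have "Some e \<in> verts ?G"
      using e F by (auto simp: branches_def)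
    ultimately show ?thesis by blast
  qed
  have "parent ` ({..<k} \<times> UNIV) \<subseteq> insert None (Some ` ({..<k} \<times> UNIV))"
  proof
    fix v assume "v \<in> parent ` ({..<k} \<times> UNIV)"
    then show "v \<in> insert None (Some ` ({..<k} \<times> UNIV))"
      by (cases v) (auto simp: parent_eq_Some_iff eq_commute[of "Some _" "parent _"])
  qed
  then have ends: "verts ?G \<noteq> {}" "tail ?G ` edges ?G \<subseteq> verts ?G" "head ?G ` edges ?G \<subseteq> verts ?G"
    by (auto simp: branches_def)
  show ?thesis
    unfolding is_tree_def using ends connected leaf by blast
qed

theorem unrooted_binary_tree:
  "is_tree unrooted_binary_tree"
  "infinite (verts unrooted_binary_tree)"
  "v \<in> verts unrooted_binary_tree \<Longrightarrow> vertex_degree unrooted_binary_tree v = 3"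
proof -
  show "is_tree unrooted_binary_tree"
    unfolding unrooted_binary_tree_def by (rule is_tree_branches)
  show "infinite (verts unrooted_binary_tree)"
    by (auto simp: unrooted_binary_tree_def branches_def finite_image_iff finite_cartesian_product_iff
        infinite_UNIV_listI lessThan_empty_iff)
  show "vertex_degree unrooted_binary_tree v = 3" if "v \<in> verts unrooted_binary_tree"
    using that degree_branches_None[of 3] degree_branches_Some[of _ 3]
    by (auto simp: unrooted_binary_tree_def branches_def)
qed

theorem rooted_binary_tree:
  "is_tree rooted_binary_tree"
  "infinite (verts rooted_binary_tree)"
  "None \<in> verts rooted_binary_tree" "vertex_degree rooted_binary_tree None = 1"
  "v \<in> verts rooted_binary_tree \<Longrightarrow> v \<noteq> None \<Longrightarrow> vertex_degree rooted_binary_tree v = 3"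
proof -
  show "is_tree rooted_binary_tree"
    unfolding rooted_binary_tree_def by (rule is_tree_branches)
  show "infinite (verts rooted_binary_tree)"
    by (auto simp: rooted_binary_tree_def branches_def finite_image_iff finite_cartesian_product_iff
        infinite_UNIV_listI lessThan_empty_iff)
  show "None \<in> verts rooted_binary_tree" "vertex_degree rooted_binary_tree None = 1"
    using degree_branches_None[of 1] by (auto simp: rooted_binary_tree_def branches_def)
  show "vertex_degree rooted_binary_tree v = 3" if "v \<in> verts rooted_binary_tree" "v \<noteq> None"
    using that degree_branches_Some[of _ 1]
    by (auto simp: rooted_binary_tree_def branches_def)
qed


subsection \<open>Sobolev spaces\<close>

definition L2_interval :: "(real \<Rightarrow> real) set" where
  "L2_interval = {f \<in> borel_measurable unit_interval. integrable unit_interval (\<lambda>x. (f x)\<^sup>2)}"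

text \<open>The test functions are the continuously differentiable functions with compact support in (0,1).\<close>

definition is_weak_deriv :: "(real \<Rightarrow> real) \<Rightarrow> (real \<Rightarrow> real) \<Rightarrow> bool" where
  "is_weak_deriv f g \<longleftrightarrow>
     (\<forall>\<phi>::real \<Rightarrow> real. \<phi> C1_differentiable_on UNIV \<and> closure {x. \<phi> x \<noteq> 0} \<subseteq> {0<..<1} \<longrightarrow>
        (LINT x|unit_interval. f x * deriv \<phi> x) = - (LINT x|unit_interval. g x * \<phi> x))"

definition H1_interval :: "(real \<Rightarrow> real) set" where
  "H1_interval = {f \<in> L2_interval. \<exists>g \<in> L2_interval. is_weak_deriv f g}"

text \<open>The weak derivative is unique up to null sets; the choice of the representative is immaterial.\<close>

definition weak_deriv :: "(real \<Rightarrow> real) \<Rightarrow> real \<Rightarrow> real" where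
  "weak_deriv f = (SOME g. g \<in> L2_interval \<and> is_weak_deriv f g)"

definition edge_deriv :: "('e \<times> real \<Rightarrow> real) \<Rightarrow> 'e \<times> real \<Rightarrow> real" where
  "edge_deriv u = (\<lambda>(e, x). weak_deriv (\<lambda>t. u (e, t)) x)"

text \<open>
  Functions on a graph G are represented by functions on pairs (e, x), only the values on points G
  being relevant. Continuity means continuity along each edge together with agreement, at each
  vertex, of the values on all edges that end there.
\<close>

definition graph_continuous :: "('v, 'e) unit_graph \<Rightarrow> ('e \<times> real \<Rightarrow> real) \<Rightarrow> bool" where
  "graph_continuous G u \<longleftrightarrow>
     (\<forall>e \<in> edges G. continuous_on {0..1} (\<lambda>x. u (e, x))) \<and>
     (\<exists>val. \<forall>e \<in> edges G. u (e, 0) = val (tail G e) \<and> u (e, 1) = val (head G e))"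

definition H1 :: "('v, 'e) unit_graph \<Rightarrow> ('e \<times> real \<Rightarrow> real) set" where
  "H1 G = {u. graph_continuous G u \<and>
              (\<forall>e \<in> edges G. (\<lambda>x. u (e, x)) \<in> H1_interval) \<and>
              integrable (length_measure G) (\<lambda>z. (edge_deriv u z)\<^sup>2 + (u z)\<^sup>2)}"

definition H1_mass :: "('v, 'e) unit_graph \<Rightarrow> real \<Rightarrow> ('e \<times> real \<Rightarrow> real) set" where
  "H1_mass G \<mu> = {u \<in> H1 G. (LINT z|length_measure G. (u z)\<^sup>2) = \<mu>}"


subsection \<open>The NLS energy and its ground state level\<close>

definition energy :: "real \<Rightarrow> ('v, 'e) unit_graph \<Rightarrow> ('e \<times> real \<Rightarrow> real) \<Rightarrow> real" where
  "energy p G u = 1 / 2 * (LINT z|length_measure G. (edge_deriv u z)\<^sup>2)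
                - 1 / p * (LINT z|length_measure G. \<bar>u z\<bar> powr p)"

definition ground_level :: "real \<Rightarrow> ('v, 'e) unit_graph \<Rightarrow> real \<Rightarrow> real" where
  "ground_level p G \<mu> = (INF u \<in> H1_mass G \<mu>. energy p G u)"

definition rayleigh_inf :: "('v, 'e) unit_graph \<Rightarrow> real" where
  "rayleigh_inf G =
     (INF u \<in> {u \<in> H1 G. \<exists>z \<in> points G. u z \<noteq> 0}.
        (LINT z|length_measure G. (edge_deriv u z)\<^sup>2) / (LINT z|length_measure G. (u z)\<^sup>2))"

text \<open>The infimum over the rooted tree has the same value, so one constant serves both trees.\<close>

definition lambda1 :: real where
  "lambda1 = rayleigh_inf unrooted_binary_tree"

end

theory Submission imports Defs begin

text \<open>
  Write \<open>D(v)\<close> for the Dirichlet integral of \<open>v\<close> and \<open>P(v)\<close> for the integral of \<open>\<bar>v\<bar> powr p\<close>. A function of mass \<open>\<mu> > 0\<close> is \<open>sqrt \<mu> * v\<close> with \<open>v\<close> of mass 1,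
  and its energy is \<open>\<mu>/2 * D(v) - \<mu> powr (p/2) / p * P(v)\<close>. Since \<open>p/2 > 1\<close>, this is concave in \<open>\<mu>\<close>, and
  therefore so is the ground level, which is the infimum over \<open>v\<close>. Discarding the nonlinear term
  gives the upper bound \<open>lambda1/2 * \<mu>\<close>, and for fixed \<open>v\<close> the nonlinear term prevails for large \<open>\<mu>\<close>, so
  the level is eventually negative.

  The lower bounds rest on two inequalities for functions \<open>v\<close> of mass 1. The Poincare inequality \<open>D(v) \<ge> 1/26\<close> (\<open>poincare\<close>) expresses the exponential growth of the tree: every edge is
  followed by two others, so the squares of the vertex values cannot be summable if they are nearly
  constant along edges. Together with the Hoelder continuity of functions with square integrable derivative it implies
  the Gagliardo-Nirenberg inequality \<open>P(v) \<le> C * D(v) powr ((p-2)/4)\<close> (\<open>potential_bound\<close>). For \<open>p < 6\<close> the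
  exponent is less than 1, hence the energy is bounded below. Because \<open>D(v)\<close> is also bounded away from
  0, \<open>P(v)\<close> is at most a constant times \<open>D(v)\<close>, so for small \<open>\<mu>\<close> the nonlinear term is negligible against
  the kinetic one and the level is \<open>lambda1/2 * \<mu> * (1 - o(1))\<close>. This is the derivative at 0. The
  shape of the graph of the level is then a matter of concavity.

  The bottom of the spectrum is the same for both trees because any number of copies
  of the rooted tree can be glued at their roots, or cut apart again (\<open>rayleigh_inf_branches\<close>).

  Weak derivatives enter through the fundamental theorem of calculus
  (\<open>weak_deriv_increment\<close>), obtained from test functions that approximate indicators of intervals, and
  through the uniqueness that follows from it (\<open>weak_deriv_unique\<close>).
\<close>

section \<open>Weak derivatives on the unit interval\<close>

lemma space_unit_interval [simp]: "space unit_interval = {0..1}"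
  by (simp add: unit_interval_def)

lemma finite_measure_unit_interval: "finite_measure unit_interval"
  unfolding unit_interval_def
  by (intro finite_measure_restrict_space finite_measureI) (auto simp: emeasure_restrict_space)

lemma measure_unit_interval [simp]: "measure unit_interval {0..1} = 1"
  by (simp add: unit_interval_def measure_restrict_space)

lemma integrable_unit_interval:
  fixes f :: "real \<Rightarrow> real"
  shows "integrable unit_interval f \<longleftrightarrow> integrable lborel (\<lambda>x. indicator {0..1} x * f x)"
  by (simp add: unit_interval_def integrable_restrict_space set_integrable_def)

lemma integral_unit_interval:
  fixes f :: "real \<Rightarrow> real"
  shows "(LINT x|unit_interval. f x) = (LINT x|lborel. indicator {0..1} x * f x)"
  by (simp add: unit_interval_def integral_restrict_space set_lebesgue_integral_def)

lemma borel_measurable_unit_interval [measurable (raw)]: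
  "f \<in> borel_measurable borel \<Longrightarrow> f \<in> borel_measurable unit_interval"
  unfolding unit_interval_def by (rule measurable_restrict_space1) simp

lemma borel_measurable_unit_interval_continuous:
  fixes f :: "real \<Rightarrow> real"
  assumes "continuous_on {0..1} f" shows "f \<in> borel_measurable unit_interval"
proof -
  have "f \<in> borel_measurable (restrict_space borel {0..1})"
    by (rule borel_measurable_continuous_on_restrict[OF assms])
  then show ?thesis
    unfolding unit_interval_def by (simp cong: measurable_cong_sets sets_restrict_space_cong)
qed

lemma integrable_unit_interval_bounded:
  fixes f :: "real \<Rightarrow> real"
  assumes "f \<in> borel_measurable unit_interval" "\<And>x. x \<in> {0..1} \<Longrightarrow> \<bar>f x\<bar> \<le> B"
  shows "integrable unit_interval f"
proof (rule finite_measure.integrable_const_bound[OF finite_measure_unit_interval])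
  show "AE x in unit_interval. norm (f x) \<le> B"
    using assms(2) by (intro AE_I2) auto
qed (rule assms(1))

text \<open>
  On a space of finite measure \<open>L\<^sup>2\<close> embeds in \<open>L\<^sup>1\<close>, by the pointwise bound \<open>\<bar>t\<bar> \<le> 1 + t\<^sup>2\<close>.
\<close>

lemma L2_interval_integrable:
  assumes "g \<in> L2_interval" shows "integrable unit_interval g"
proof (rule Bochner_Integration.integrable_bound)
  show "integrable unit_interval (\<lambda>x. 1 + (g x)\<^sup>2)"
    using assms finite_measure_unit_interval
    by (auto simp: L2_interval_def finite_measure.integrable_const)
  show "g \<in> borel_measurable unit_interval"
    using assms by (simp add: L2_interval_def)
  have "\<bar>t\<bar> \<le> 1 + t\<^sup>2" for t :: real
    using zero_le_power2[of "\<bar>t\<bar> - 1"] zero_le_power2[of t] unfolding power2_diff by (simp)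
  then show "AE x in unit_interval. norm (g x) \<le> norm (1 + (g x)\<^sup>2)"
    by (auto intro: order_trans)
qed

text \<open>
  The quadratic truncated power: its derivative, the truncated power \<open>2 * max 0 t\<close>, is continuous.
\<close>

definition pos_sq :: "real \<Rightarrow> real" where "pos_sq t = (max 0 t)\<^sup>2"

lemma pos_sq_deriv: "(pos_sq has_real_derivative 2 * max 0 t) (at t)"
proof -
  consider "t < 0" | "t = 0" | "t > 0" by linarith
  then show ?thesis
  proof cases
    case 1
    have "((\<lambda>_. 0) has_real_derivative 2 * max 0 t) (at t)" using 1 by simp
    then show ?thesis
      by (rule has_field_derivative_transform_within_open[where S="{..<0}"]) (use 1 in \<open>auto simp: pos_sq_def\<close>)
  next
    case 3
    have "((\<lambda>t. t\<^sup>2) has_real_derivative 2 * max 0 t) (at t)"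
      using 3 by (auto intro!: derivative_eq_intros)
    then show ?thesis
      by (rule has_field_derivative_transform_within_open[where S="{0<..}"]) (use 3 in \<open>auto simp: pos_sq_def\<close>)
  next
    case 2
    have "((\<lambda>h. max 0 h * (max 0 h / h)) \<longlongrightarrow> 0) (at (0::real))"
    proof (rule Lim_null_comparison)
      show "\<forall>\<^sub>F h in at (0::real). norm (max 0 h * (max 0 h / h)) \<le> \<bar>h\<bar>"
        by (auto intro!: always_eventually simp: max_def)
      show "((\<lambda>h. \<bar>h\<bar>) \<longlongrightarrow> 0) (at (0::real))"
        by (rule tendsto_eq_intros | simp)+
    qed
    then show ?thesis
      using 2 by (simp add: DERIV_def pos_sq_def power2_eq_square)
  qed
qed

text \<open>
  A continuously differentiable step from 0 to 1 on \<open>[0,1]\<close>. As a second difference of truncated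
  squares it has a piecewise linear hat function of unit mass as its derivative.
\<close>

definition ramp :: "real \<Rightarrow> real" where
  "ramp t = (pos_sq (2*t) - 2 * pos_sq (2*t-1) + pos_sq (2*t-2)) / 2"

definition ramp' :: "real \<Rightarrow> real" where
  "ramp' t = 2 * (max 0 (2*t) - 2 * max 0 (2*t-1) + max 0 (2*t-2))"

lemma ramp_deriv: "(ramp has_real_derivative ramp' t) (at t)"
proof -
  have D: "((\<lambda>t. pos_sq (2 * t - c)) has_real_derivative 2 * max 0 (2 * t - c) * 2) (at t)" for c
    by (rule DERIV_chain2[OF pos_sq_deriv]) (auto intro!: derivative_eq_intros)
  show ?thesis
    using DERIV_cdivide[OF DERIV_add[OF DERIV_diff[OF D[of 0] DERIV_cmult[OF D[of 1], of 2]] D[of 2]], of 2]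
    by (simp add: ramp_def[abs_def] ramp'_def add_divide_distrib diff_divide_distrib)
qed

lemma ramp_0: "t \<le> 0 \<Longrightarrow> ramp t = 0"
  by (simp add: ramp_def pos_sq_def)

lemma ramp_1: "t \<ge> 1 \<Longrightarrow> ramp t = 1"
  by (simp add: ramp_def pos_sq_def power2_eq_square field_simps)

lemma ramp'_0: "t \<le> 0 \<or> t \<ge> 1 \<Longrightarrow> ramp' t = 0"
  by (auto simp: ramp'_def max_def)

lemma ramp'_nonneg: "0 \<le> ramp' t"
  by (auto simp: ramp'_def max_def)

lemma continuous_on_ramp': "continuous_on A ramp'"
  unfolding ramp'_def by (intro continuous_intros)

lemma ramp_mono: "s \<le> t \<Longrightarrow> ramp s \<le> ramp t"
  by (rule DERIV_nonneg_imp_nondecreasing) (use ramp_deriv ramp'_nonneg in blast)+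

lemma ramp_bounds: "0 \<le> ramp t" "ramp t \<le> 1"
  using ramp_mono[of "min t 0" t] ramp_mono[of t "max t 1"] by (auto simp: ramp_0 ramp_1)

lemma integral_ramp': "(LINT t|lborel. ramp' t) = 1" and integrable_ramp': "integrable lborel ramp'"
proof -
  have "has_bochner_integral lborel (\<lambda>t. ramp' t * indicator {0..1} t) (ramp 1 - ramp 0)"
    by (rule has_bochner_integral_FTC_Icc_real)
       (use ramp_deriv continuous_on_ramp'[of UNIV] in \<open>auto simp: continuous_on_eq_continuous_at\<close>)
  also have "(\<lambda>t. ramp' t * indicator {0..1} t) = ramp'"
  proof
    show "ramp' t * indicator {0..1} t = ramp' t" for t
      using ramp'_0[of t] by (cases "t \<in> {0..1}") auto
  qed
  finally have "has_bochner_integral lborel ramp' 1" by (simp add: ramp_0 ramp_1)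
  then show "(LINT t|lborel. ramp' t) = 1" "integrable lborel ramp'"
    by (auto simp: has_bochner_integral_iff)
qed

text \<open>
  The derivative of a rescaled ramp is an averaging kernel; substituting \<open>t = a + h * s\<close> moves the
  scale from the kernel to the function.
\<close>

lemma ramp_average:
  fixes f :: "real \<Rightarrow> real"
  assumes "0 < h"
  shows "(LINT t|unit_interval. f t * (ramp' ((t - a) / h) / h))
       = (LINT s|lborel. indicator {0..1} (a + h * s) * f (a + h * s) * ramp' s)"
proof -
  have "(LINT t|unit_interval. f t * (ramp' ((t - a) / h) / h))
     = (LINT t|lborel. indicator {0..1} t * (f t * (ramp' ((t - a) / h) / h)))"
    by (rule integral_unit_interval)
  also have "\<dots> = \<bar>h\<bar> *\<^sub>R (LINT s|lborel. indicator {0..1} (a + h * s) * (f (a + h * s) * (ramp' ((a + h * s - a) / h) / h)))"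
    by (rule lborel_integral_real_affine) (use assms in simp)
  also have "\<dots> = (LINT s|lborel. h * (indicator {0..1} (a + h * s) * (f (a + h * s) * (ramp' s / h))))"
    using assms by simp
  also have "\<dots> = (LINT s|lborel. indicator {0..1} (a + h * s) * f (a + h * s) * ramp' s)"
    using assms by (intro Bochner_Integration.integral_cong) auto
  finally show ?thesis .
qed

text \<open>
  The kernels concentrate at \<open>x\<close>. Their supports \<open>[a n, a n + h n]\<close> are required to stay inside
  \<open>[0,1]\<close>, so that the limit is \<open>f x\<close> even if \<open>x\<close> is an endpoint.
\<close>

lemma ramp_average_tendsto:
  fixes f :: "real \<Rightarrow> real"
  assumes f: "continuous_on {0..1} f" and x: "x \<in> {0..1}"
    and in01: "\<And>n s. 0 \<le> s \<Longrightarrow> s \<le> 1 \<Longrightarrow> a n + h n * s \<in> {0..1}"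
    and a: "a \<longlonglongrightarrow> x" and h: "h \<longlonglongrightarrow> 0" "\<And>n. 0 < h n"
  shows "(\<lambda>n. LINT t|unit_interval. f t * (ramp' ((t - a n) / h n) / h n)) \<longlonglongrightarrow> f x"
proof -
  obtain B where B: "\<And>t. t \<in> {0..1} \<Longrightarrow> \<bar>f t\<bar> \<le> B"
    using compact_continuous_image[OF f compact_Icc]
    by (meson bounded_real compact_imp_bounded image_eqI)
  have "B \<ge> 0" using B[OF x] by simp
  let ?F = "\<lambda>t. indicator {0..1} t * f t"
  have mF: "?F \<in> borel_measurable borel"
    using borel_measurable_continuous_on_indicator[OF _ f] by simp
  have "(\<lambda>n. LINT s|lborel. ?F (a n + h n * s) * ramp' s) \<longlonglongrightarrow> (LINT s|lborel. f x * ramp' s)"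
  proof (rule integral_dominated_convergence)
    show "(\<lambda>s. f x * ramp' s) \<in> borel_measurable lborel"
      by (intro borel_measurable_times borel_measurable_const) (use continuous_on_ramp' in \<open>simp add: borel_measurable_continuous_onI\<close>)
    have mr: "ramp' \<in> borel_measurable borel"
      using continuous_on_ramp' by (simp add: borel_measurable_continuous_onI)
    show "(\<lambda>s. ?F (a n + h n * s) * ramp' s) \<in> borel_measurable lborel" for n
    proof (rule borel_measurable_times)
      show "(\<lambda>s. ?F (a n + h n * s)) \<in> borel_measurable lborel"
        by (rule measurable_compose[OF _ mF]) simp
    qed (use mr in simp)
    show "integrable lborel (\<lambda>s. B * ramp' s)" using integrable_ramp' by simp
    show "AE s in lborel. norm (?F (a n + h n * s) * ramp' s) \<le> B * ramp' s" for n
      using B \<open>B \<ge> 0\<close> ramp'_nonneg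
      by (intro AE_I2) (auto simp: abs_mult indicator_def intro!: mult_right_mono)
    have "(\<lambda>n. ?F (a n + h n * s) * ramp' s) \<longlonglongrightarrow> f x * ramp' s" for s
    proof (cases "0 \<le> s \<and> s \<le> 1")
      case True
      have "(\<lambda>n. a n + h n * s) \<longlonglongrightarrow> x + 0 * s" by (intro tendsto_intros a h)
      then have "(\<lambda>n. f (a n + h n * s)) \<longlonglongrightarrow> f x"
        using f x in01 True unfolding continuous_on_sequentially comp_def by auto
      then have "(\<lambda>n. f (a n + h n * s) * ramp' s) \<longlonglongrightarrow> f x * ramp' s" by (intro tendsto_intros)
      then show ?thesis using in01[of s] True by simp
    next
      case False
      then show ?thesis using ramp'_0[of s] by auto
    qed
    then show "AE s in lborel. (\<lambda>n. ?F (a n + h n * s) * ramp' s) \<longlonglongrightarrow> f x * ramp' s" by simp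
  qed
  then show ?thesis
    unfolding ramp_average[OF h(2)] by (simp add: integral_ramp')
qed

text \<open>
  The fundamental theorem of calculus for weak derivatives. A test function that rises by a ramp just
  after \<open>x\<close> and falls by a ramp just before \<open>y\<close> approximates the indicator of \<open>(x,y)\<close>. As the ramps
  steepen, the integral of \<open>f\<close> against its derivative tends to \<open>f x - f y\<close>, because the derivative
  consists of two averaging kernels of opposite sign, while the integral of \<open>g\<close> against it tends to
  the integral of \<open>g\<close> over \<open>(x,y)\<close> by dominated convergence.
\<close>

lemma weak_deriv_increment:
  fixes f :: "real \<Rightarrow> real"
  assumes f: "continuous_on {0..1} f" and g: "g \<in> L2_interval" and w: "is_weak_deriv f g"
    and xy: "0 \<le> x" "x \<le> y" "y \<le> 1"
  shows "f y - f x = (LINT t|unit_interval. indicator {x<..<y} t * g t)"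
proof (cases "x = y")
  case False
  \<comment> \<open>The ramps occupy [x + h, x + 2h] and [y - 2h, y - h]; both fit between x and y, off the endpoints, as 4h is at most y - x.\<close>
  define h where "h n = (y - x) / 4 / real (Suc n)" for n
  have h0: "h n > 0" for n using False xy by (simp add: h_def)
  have h1: "4 * h n \<le> y - x" for n
  proof -
    have "4 * h n = (y - x) / real (Suc n)"
    proof -
      have "4 * (d / 4 / c) = d / c" for d c :: real by simp
      then show ?thesis unfolding h_def .
    qed
    also have "\<dots> \<le> (y - x) / 1" using xy by (intro divide_left_mono) auto
    finally show ?thesis by simp
  qed
  have hlim: "h \<longlonglongrightarrow> 0"
  proof -
    have "h = (\<lambda>n. (y - x) / 4 * inverse (real (Suc n)))"
      by (simp only: h_def[abs_def] divide_inverse)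
    then show ?thesis
      by (simp only: tendsto_mult_right_zero[OF LIMSEQ_inverse_real_of_nat])
  qed
  define a where "a n = x + h n" for n
  define b where "b n = y - 2 * h n" for n
  define \<phi> where "\<phi> n t = ramp ((t - a n) / h n) - ramp ((t - b n) / h n)" for n t
  define \<phi>' where "\<phi>' n t = ramp' ((t - a n) / h n) / h n - ramp' ((t - b n) / h n) / h n" for n t
  have d: "(\<phi> n has_real_derivative \<phi>' n t) (at t)" for n t
  proof -
    have "((\<lambda>t. ramp ((t - c) / h n)) has_real_derivative ramp' ((t - c) / h n) * (1 / h n)) (at t)" for c
      by (rule DERIV_chain2[OF ramp_deriv]) (use h0[of n] in \<open>auto intro!: derivative_eq_intros\<close>)
    from DERIV_diff[OF this[of "a n"] this[of "b n"]] show ?thesis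
      by (simp add: \<phi>_def[abs_def] \<phi>'_def)
  qed
  have cont': "continuous_on A (\<phi>' n)" for n A
    unfolding \<phi>'_def using h0[of n]
    by (auto intro!: continuous_intros continuous_on_compose2[OF continuous_on_ramp'[of UNIV]])
  have C1: "\<phi> n C1_differentiable_on UNIV" for n
    unfolding C1_differentiable_on_def
    using d cont' by (intro exI[of _ "\<phi>' n"]) (simp add: has_real_derivative_iff_has_vector_derivative)
  have \<phi>0: "\<phi> n t = 0" if "t \<notin> {x + h n..y - h n}" for n t
  proof -
    have "t \<le> a n \<or> t \<ge> y - h n" using that by (auto simp: a_def)
    then show ?thesis
    proof
      assume "t \<le> a n"
      moreover have "a n \<le> b n" using h1[of n] h0[of n] by (simp add: a_def b_def)
      ultimately show ?thesis using h0[of n] by (simp add: \<phi>_def ramp_0 divide_nonpos_pos)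
    next
      assume "t \<ge> y - h n"
      then have "(t - b n) / h n \<ge> 1" "(t - a n) / h n \<ge> 1"
        using h0[of n] h1[of n] by (auto simp: b_def a_def field_simps)
      then show ?thesis by (simp add: \<phi>_def ramp_1)
    qed
  qed
  have supp: "closure {t. \<phi> n t \<noteq> 0} \<subseteq> {0<..<1}" for n
  proof -
    have "closure {t. \<phi> n t \<noteq> 0} \<subseteq> {x + h n..y - h n}"
      by (rule closure_minimal) (use \<phi>0 in blast, rule closed_atLeastAtMost)
    then show ?thesis using h0[of n] xy by fastforce
  qed
  have deriv: "deriv (\<phi> n) = \<phi>' n" for n
    using d by (auto intro: DERIV_imp_deriv)
  have eq: "(LINT t|unit_interval. f t * \<phi>' n t) = - (LINT t|unit_interval. g t * \<phi> n t)" for n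
    using w C1 supp unfolding is_weak_deriv_def deriv[symmetric] by blast
  have int: "integrable unit_interval (\<lambda>t. f t * (ramp' ((t - c) / h n) / h n))" for c n
  proof -
    have "continuous_on {0..1} (\<lambda>t. f t * (ramp' ((t - c) / h n) / h n))"
      using h0[of n]
      by (auto intro!: continuous_intros f continuous_on_compose2[OF continuous_on_ramp'[of UNIV]])
    then have "integrable lborel (\<lambda>t. indicator {0..1} t *\<^sub>R (f t * (ramp' ((t - c) / h n) / h n)))"
      by (intro borel_integrable_compact) auto
    then show ?thesis by (simp add: integrable_unit_interval)
  qed
  have "(\<lambda>n. (LINT t|unit_interval. f t * (ramp' ((t - a n) / h n) / h n))
           - (LINT t|unit_interval. f t * (ramp' ((t - b n) / h n) / h n))) \<longlonglongrightarrow> f x - f y"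
  proof (intro tendsto_diff ramp_average_tendsto f hlim h0)
    show "x \<in> {0..1}" "y \<in> {0..1}" using xy by auto
    show "a \<longlonglongrightarrow> x" unfolding a_def using tendsto_add[OF tendsto_const[of x] hlim] by simp
    show "b \<longlonglongrightarrow> y" unfolding b_def
      using tendsto_diff[OF tendsto_const[of y] tendsto_mult[OF tendsto_const[of 2] hlim]] by simp
    fix n and s :: real assume s: "0 \<le> s" "s \<le> 1"
    have "0 \<le> h n * s" "h n * s \<le> h n" using s h0[of n] by (auto simp: mult_left_le)
    then show "a n + h n * s \<in> {0..1}" "b n + h n * s \<in> {0..1}"
      using xy h1[of n] h0[of n] unfolding a_def b_def atLeastAtMost_iff by linarith+
  qed
  moreover have "(LINT t|unit_interval. f t * (ramp' ((t - a n) / h n) / h n))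
           - (LINT t|unit_interval. f t * (ramp' ((t - b n) / h n) / h n)) = - (LINT t|unit_interval. g t * \<phi> n t)" for n
    unfolding eq[symmetric] \<phi>'_def right_diff_distrib
    by (rule Bochner_Integration.integral_diff[symmetric]) (rule int)+
  ultimately have lim1: "(\<lambda>n. - (LINT t|unit_interval. g t * \<phi> n t)) \<longlonglongrightarrow> f x - f y" by simp
  have mg: "g \<in> borel_measurable unit_interval" using g by (simp add: L2_interval_def)
  have "(\<lambda>n. LINT t|unit_interval. g t * \<phi> n t) \<longlonglongrightarrow> (LINT t|unit_interval. indicator {x<..<y} t * g t)"
  proof (rule integral_dominated_convergence)
    show "(\<lambda>t. indicator {x<..<y} t * g t) \<in> borel_measurable unit_interval"
      by (intro borel_measurable_times mg borel_measurable_unit_interval) auto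
    have "\<phi> n \<in> borel_measurable borel" for n
      by (rule borel_measurable_continuous_onI) (use d in \<open>meson DERIV_isCont continuous_at_imp_continuous_on\<close>)
    then show "(\<lambda>t. g t * \<phi> n t) \<in> borel_measurable unit_interval" for n
      by (intro borel_measurable_times mg borel_measurable_unit_interval) auto
    show "integrable unit_interval (\<lambda>t. \<bar>g t\<bar>)"
      using L2_interval_integrable[OF g] by simp
    have "\<bar>\<phi> n t\<bar> \<le> 1" for n t
      using ramp_bounds[of "(t - a n) / h n"] ramp_bounds[of "(t - b n) / h n"] by (simp add: \<phi>_def)
    then show "AE t in unit_interval. norm (g t * \<phi> n t) \<le> \<bar>g t\<bar>" for n
      by (simp add: abs_mult mult_left_le)
    have "(\<lambda>n. g t * \<phi> n t) \<longlonglongrightarrow> indicator {x<..<y} t * g t" for t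
    proof (cases "t \<in> {x<..<y}")
      case True
      then have "\<forall>\<^sub>F n in sequentially. h n < min ((t - x)/2) ((y - t)/2)"
        using hlim by (intro order_tendstoD) auto
      then have "\<forall>\<^sub>F n in sequentially. \<phi> n t = 1"
      proof eventually_elim
        case (elim n)
        then have "(t - a n) / h n \<ge> 1" "(t - b n) / h n \<le> 0"
          using h0[of n] by (auto simp: a_def b_def field_simps)
        then show ?case by (simp add: \<phi>_def ramp_0 ramp_1)
      qed
      then have "(\<lambda>n. \<phi> n t) \<longlonglongrightarrow> 1" by (rule tendsto_eventually)
      then have "(\<lambda>n. g t * \<phi> n t) \<longlonglongrightarrow> g t * 1" by (intro tendsto_intros)
      then show ?thesis using True by simp
    next
      case False
      have "\<phi> n t = 0" for n using False h0[of n] by (intro \<phi>0) auto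
      then show ?thesis using False by simp
    qed
    then show "AE t in unit_interval. (\<lambda>n. g t * \<phi> n t) \<longlonglongrightarrow> indicator {x<..<y} t * g t" by simp
  qed
  then have "(\<lambda>n. - (LINT t|unit_interval. g t * \<phi> n t)) \<longlonglongrightarrow> - (LINT t|unit_interval. indicator {x<..<y} t * g t)"
    by (rule tendsto_minus)
  from LIMSEQ_unique[OF lim1 this] show ?thesis by simp
qed simp

section \<open>Pointwise estimates and uniqueness of weak derivatives\<close>

lemma integral_indicator_Ioo_unit_interval:
  fixes a b :: real
  assumes "0 \<le> a" "a \<le> b" "b \<le> 1"
  shows "(LINT t|unit_interval. indicator {a<..<b} t) = b - a"
proof -
  have "(LINT t|unit_interval. indicator {a<..<b} t) = (LINT t|lborel. indicator {a<..<b} t :: real)"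
    unfolding integral_unit_interval
    by (rule Bochner_Integration.integral_cong) (use assms in \<open>auto simp: indicator_def\<close>)
  then show ?thesis using assms by simp
qed

lemma borel_measurable_indicator_Ioo [measurable]:
  "(indicator {a<..<b} :: real \<Rightarrow> real) \<in> borel_measurable unit_interval"
  by (rule borel_measurable_unit_interval) simp

lemma integrable_indicator_mult:
  fixes g :: "real \<Rightarrow> real"
  assumes "integrable unit_interval g"
  shows "integrable unit_interval (\<lambda>t. indicator {a<..<b} t * g t)"
proof (rule Bochner_Integration.integrable_bound[OF assms])
  show "(\<lambda>t. indicator {a<..<b} t * g t) \<in> borel_measurable unit_interval"
    using assms by (intro borel_measurable_times) auto
qed (auto simp: indicator_def)

lemma integrable_indicator_Ioo [simp]:
  "integrable unit_interval (indicator {a<..<b} :: real \<Rightarrow> real)"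
  by (rule integrable_unit_interval_bounded[where B = 1]) (auto simp: indicator_def)

text \<open>
  The Hoelder estimate with exponent 1/2, which is the Cauchy-Schwarz inequality for the increment. It
  carries all the pointwise bounds below.
\<close>

lemma square_diff_le:
  fixes f g :: "real \<Rightarrow> real"
  assumes f: "continuous_on {0..1} f" and g: "g \<in> L2_interval" and w: "is_weak_deriv f g"
    and xy: "x \<in> {0..1}" "y \<in> {0..1}"
  shows "(f y - f x)\<^sup>2 \<le> \<bar>y - x\<bar> * (LINT t|unit_interval. (g t)\<^sup>2)"
proof -
  have *: "(f y - f x)\<^sup>2 \<le> (y - x) * (LINT t|unit_interval. (g t)\<^sup>2)" if "0 \<le> x" "x < y" "y \<le> 1" for x y
  proof -
    let ?J = "indicator {x<..<y} :: real \<Rightarrow> real"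
    define h where "h = y - x"
    define I where "I = (LINT t|unit_interval. ?J t * g t)"
    have ig: "integrable unit_interval g" and ig2: "integrable unit_interval (\<lambda>t. (g t)\<^sup>2)"
      using L2_interval_integrable[OF g] g by (auto simp: L2_interval_def)
    have ints: "integrable unit_interval (\<lambda>t. h\<^sup>2 * (?J t * (g t)\<^sup>2))"
      "integrable unit_interval (\<lambda>t. 2 * h * I * (?J t * g t))"
      "integrable unit_interval (\<lambda>t. I\<^sup>2 * ?J t)"
      by (intro integrable_mult_right integrable_indicator_mult ig ig2 integrable_indicator_Ioo)+
    \<comment> \<open>Up to a positive factor this is the variance of g on (x,y), where its mean is I / h.\<close>
    have "0 \<le> (LINT t|unit_interval. ?J t * (h * g t - I)\<^sup>2)"
      by (rule Bochner_Integration.integral_nonneg) simp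
    also have "(\<lambda>t. ?J t * (h * g t - I)\<^sup>2) = (\<lambda>t. h\<^sup>2 * (?J t * (g t)\<^sup>2) - 2 * h * I * (?J t * g t) + I\<^sup>2 * ?J t)"
      by (simp add: power2_eq_square algebra_simps fun_eq_iff)
    also have "(LINT t|unit_interval. \<dots> t) = h\<^sup>2 * (LINT t|unit_interval. ?J t * (g t)\<^sup>2) - 2 * h * I * I + I\<^sup>2 * h"
      using that integral_indicator_Ioo_unit_interval[of x y]
      unfolding Bochner_Integration.integral_add[OF Bochner_Integration.integrable_diff[OF ints(1,2)] ints(3)]
        Bochner_Integration.integral_diff[OF ints(1,2)]
      by (simp add: I_def h_def del: Int_atLeastAtMost)
    also have "\<dots> = h * (h * (LINT t|unit_interval. ?J t * (g t)\<^sup>2) - I\<^sup>2)"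
      by (simp add: power2_eq_square algebra_simps)
    finally have "I\<^sup>2 \<le> h * (LINT t|unit_interval. ?J t * (g t)\<^sup>2)"
      using that by (simp add: h_def zero_le_mult_iff)
    also have "\<dots> \<le> h * (LINT t|unit_interval. (g t)\<^sup>2)"
      using that by (intro mult_left_mono integral_mono integrable_indicator_mult ig2)
        (auto simp: h_def indicator_def)
    finally show ?thesis
      using weak_deriv_increment[OF f g w, of x y] that by (simp add: I_def h_def)
  qed
  consider "x < y" | "x = y" | "y < x" by linarith
  then show ?thesis
    using *[of x y] *[of y x] xy by cases (auto simp: power2_commute)
qed

lemma continuous_L2_interval:
  assumes "continuous_on {0..1} f" shows "f \<in> L2_interval"
proof -
  have "integrable lborel (\<lambda>t. indicator {0..1} t *\<^sub>R (f t)\<^sup>2)"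
    by (intro borel_integrable_compact continuous_intros assms) auto
  then show ?thesis
    using borel_measurable_unit_interval_continuous[OF assms]
    by (simp add: L2_interval_def integrable_unit_interval)
qed

text \<open>
  A value is compared with the average over an interval of length \<open>h\<close> containing the point. The length
  is left free: optimising it later turns the additive bound into a multiplicative one of
  Gagliardo-Nirenberg type.
\<close>

lemma point_le_average:
  fixes f g :: "real \<Rightarrow> real"
  assumes f: "continuous_on {0..1} f" and g: "g \<in> L2_interval" and w: "is_weak_deriv f g"
    and x: "x \<in> {0..1}" and h: "0 < h" "h \<le> 1"
  shows "(f x)\<^sup>2 \<le> 2 / h * (LINT t|unit_interval. (f t)\<^sup>2) + 2 * h * (LINT t|unit_interval. (g t)\<^sup>2)"
proof -
  define D where "D = (LINT t|unit_interval. (g t)\<^sup>2)"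
  \<comment> \<open>The interval (a, a + h) has x in its closure and lies in [0,1], also if x is close to 1.\<close>
  define a where "a = min x (1 - h)"
  let ?J = "indicator {a<..<a+h} :: real \<Rightarrow> real"
  have a: "0 \<le> a" "a + h \<le> 1" "a \<le> x" "x \<le> a + h" using x h by (auto simp: a_def)
  have "D \<ge> 0" by (simp add: D_def)
  have if2: "integrable unit_interval (\<lambda>t. (f t)\<^sup>2)"
    using continuous_L2_interval[OF f] by (simp add: L2_interval_def)
  have pt: "(f x)\<^sup>2 \<le> 2 * (f t)\<^sup>2 + 2 * h * D" if "t \<in> {a<..<a+h}" for t
  proof -
    have "(f x - f t)\<^sup>2 \<le> \<bar>x - t\<bar> * D"
      unfolding D_def using that a x by (intro square_diff_le[OF f g w]) auto
    also have "\<dots> \<le> h * D" using that a \<open>D \<ge> 0\<close> by (intro mult_right_mono) auto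
    finally have "(f x - f t)\<^sup>2 \<le> h * D" .
    moreover have "(f x)\<^sup>2 \<le> 2 * (f t)\<^sup>2 + 2 * (f x - f t)\<^sup>2"
      using zero_le_power2[of "2 * f t - f x"] by (simp add: power2_eq_square algebra_simps)
    ultimately show ?thesis by simp
  qed
  have "h * (f x)\<^sup>2 = (LINT t|unit_interval. (f x)\<^sup>2 * ?J t)"
    using a h integral_indicator_Ioo_unit_interval[of a "a + h"] by (simp add: mult.commute)
  also have "\<dots> \<le> (LINT t|unit_interval. 2 * (?J t * (f t)\<^sup>2) + 2 * h * D * ?J t)"
  proof (rule integral_mono)
    show "(f x)\<^sup>2 * ?J t \<le> 2 * (?J t * (f t)\<^sup>2) + 2 * h * D * ?J t" for t
      using pt[of t] by (auto simp: indicator_def)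
  qed (intro integrable_mult_right Bochner_Integration.integrable_add integrable_indicator_mult if2 integrable_indicator_Ioo)+
  also have "\<dots> = 2 * (LINT t|unit_interval. ?J t * (f t)\<^sup>2) + 2 * h * D * h"
    using a h integral_indicator_Ioo_unit_interval[of a "a + h"] by (simp add: integrable_indicator_mult if2)
  also have "\<dots> \<le> 2 * (LINT t|unit_interval. (f t)\<^sup>2) + 2 * h * D * h"
    by (intro add_right_mono mult_left_mono integral_mono integrable_indicator_mult if2)
       (auto simp: indicator_def)
  finally have "(f x)\<^sup>2 \<le> (2 * (LINT t|unit_interval. (f t)\<^sup>2) + 2 * h * D * h) / h"
    using h by (simp add: pos_le_divide_eq mult.commute)
  then show ?thesis using h by (simp add: D_def add_divide_distrib)
qed

lemma average_le_point:
  fixes f g :: "real \<Rightarrow> real"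
  assumes f: "continuous_on {0..1} f" and g: "g \<in> L2_interval" and w: "is_weak_deriv f g"
    and x: "x \<in> {0..1}"
  shows "(LINT t|unit_interval. (f t)\<^sup>2) \<le> 2 * (f x)\<^sup>2 + 2 * (LINT t|unit_interval. (g t)\<^sup>2)"
proof -
  define D where "D = (LINT t|unit_interval. (g t)\<^sup>2)"
  have "D \<ge> 0" by (simp add: D_def)
  have "(LINT t|unit_interval. (f t)\<^sup>2) \<le> (LINT t|unit_interval. 2 * (f x)\<^sup>2 + 2 * D)"
  proof (rule integral_mono)
    show "integrable unit_interval (\<lambda>t. (f t)\<^sup>2)"
      using continuous_L2_interval[OF f] by (simp add: L2_interval_def)
    show "integrable unit_interval (\<lambda>t. 2 * (f x)\<^sup>2 + 2 * D)"
      by (rule integrable_unit_interval_bounded[where B = "2 * (f x)\<^sup>2 + 2 * D"]) (use \<open>D \<ge> 0\<close> in auto)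
    fix t assume "t \<in> space unit_interval"
    then have t: "t \<in> {0..1}" by simp
    have "(f t - f x)\<^sup>2 \<le> \<bar>t - x\<bar> * D"
      unfolding D_def by (rule square_diff_le[OF f g w x t])
    also have "\<dots> \<le> 1 * D" using t x \<open>D \<ge> 0\<close> by (intro mult_right_mono) auto
    finally have "(f t - f x)\<^sup>2 \<le> D" by simp
    moreover have "(f t)\<^sup>2 \<le> 2 * (f x)\<^sup>2 + 2 * (f t - f x)\<^sup>2"
      using zero_le_power2[of "2 * f x - f t"] by (simp add: power2_eq_square algebra_simps)
    ultimately show "(f t)\<^sup>2 \<le> 2 * (f x)\<^sup>2 + 2 * D" by simp
  qed
  then show ?thesis by (simp add: D_def)
qed

text \<open>
  Two weak derivatives of the same continuous function have the same integral over every interval,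
  hence over every Borel set, since the open intervals form an intersection-stable generator.
\<close>

lemma weak_deriv_unique:
  fixes f :: "real \<Rightarrow> real"
  assumes f: "continuous_on {0..1} f"
    and g1: "g1 \<in> L2_interval" "is_weak_deriv f g1" and g2: "g2 \<in> L2_interval" "is_weak_deriv f g2"
  shows "AE t in unit_interval. g1 t = g2 t"
proof -
  define k where "k t = g1 t - g2 t" for t
  have i1: "integrable unit_interval g1" and i2: "integrable unit_interval g2"
    using g1 g2 L2_interval_integrable by auto
  have ik: "integrable unit_interval k"
    unfolding k_def[abs_def] by (intro Bochner_Integration.integrable_diff i1 i2)
  have mk: "k \<in> borel_measurable unit_interval" using ik by simp
  have sub: "(LINT t|unit_interval. indicator {a<..<b} t * k t) = 0" if "0 \<le> a" "a \<le> b" "b \<le> 1" for a b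
  proof -
    have "(LINT t|unit_interval. indicator {a<..<b} t * k t)
        = (LINT t|unit_interval. indicator {a<..<b} t * g1 t) - (LINT t|unit_interval. indicator {a<..<b} t * g2 t)"
      unfolding k_def right_diff_distrib
      by (intro Bochner_Integration.integral_diff integrable_indicator_mult i1 i2)
    also have "\<dots> = 0"
      using weak_deriv_increment[OF f g1 that] weak_deriv_increment[OF f g2 that] by simp
    finally show ?thesis .
  qed
  have AE01: "AE t in unit_interval. t \<noteq> 0 \<and> t \<noteq> 1"
  proof -
    have "AE t in lborel. t \<in> {0..1} \<longrightarrow> t \<noteq> 0 \<and> t \<noteq> (1::real)"
      using AE_lborel_singleton[of "0::real"] AE_lborel_singleton[of "1::real"] by eventually_elim simp
    then show ?thesis unfolding unit_interval_def by (subst AE_restrict_space_iff) auto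
  qed
  have Ioo: "(LINT t|unit_interval. indicator {a<..<b} t * k t) = 0" for a b
  proof (cases "max a 0 \<le> min b 1")
    case True
    have "(LINT t|unit_interval. indicator {a<..<b} t * k t)
        = (LINT t|unit_interval. indicator {max a 0<..<min b 1} t * k t)"
    proof (rule integral_cong_AE)
      show "(\<lambda>t. indicator {a<..<b} t * k t) \<in> borel_measurable unit_interval" for a b
        by (intro borel_measurable_times mk borel_measurable_indicator_Ioo)
      then show "(\<lambda>t. indicator {max a 0<..<min b 1} t * k t) \<in> borel_measurable unit_interval" .
      show "AE t in unit_interval. indicator {a<..<b} t * k t = indicator {max a 0<..<min b 1} t * k t"
        using AE01 AE_space by eventually_elim (auto simp: indicator_def)
    qed
    also have "\<dots> = 0" using True by (intro sub) auto
    finally show ?thesis .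
  next
    case False
    have "(LINT t|unit_interval. indicator {a<..<b} t * k t) = (LINT t|unit_interval. 0)"
      by (rule Bochner_Integration.integral_cong) (use False in \<open>auto simp: indicator_def\<close>)
    then show ?thesis by simp
  qed
  have mem: "A \<inter> {0..1} \<in> sets unit_interval" if "A \<in> sets borel" for A
    using that by (auto simp: unit_interval_def sets_restrict_space)
  have si: "set_integrable unit_interval (A \<inter> {0..1}) k" if "A \<in> sets borel" for A
    unfolding set_integrable_def using integrable_mult_indicator[OF mem[OF that] ik] .
  have borel: "sets borel = sigma_sets UNIV (range (\<lambda>(a, b). {a<..<b::real}))"
  proof -
    have "(\<lambda>(a, b). box a b) = (\<lambda>(a, b). {a<..<b::real})" by (auto simp: fun_eq_iff)
    then show ?thesis by (subst borel_eq_box) (simp only: sets_measure_of Pow_UNIV subset_UNIV)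
  qed
  have stable: "Int_stable (range (\<lambda>(a, b). {a<..<b::real}))"
    by (auto simp: Int_stable_def intro!: range_eqI[of _ _ "(max _ _, min _ _)"])
  have "range (\<lambda>(a, b). {a<..<b::real}) \<subseteq> Pow UNIV" by simp
  note induct = sigma_sets_induct_disjoint[OF stable this, case_names basic empty compl union, consumes 1]
  have "A \<in> sigma_sets UNIV (range (\<lambda>(a, b). {a<..<b::real})) \<Longrightarrow>
     set_lebesgue_integral unit_interval (A \<inter> {0..1}) k = 0" for A
  proof (induction rule: induct)
    case (basic A)
    then obtain a b where "A = {a<..<b}" by auto
    have "set_lebesgue_integral unit_interval (A \<inter> {0..1}) k = (LINT t|unit_interval. indicator {a<..<b} t * k t)"
      unfolding set_lebesgue_integral_def
      by (rule Bochner_Integration.integral_cong) (auto simp: indicator_def \<open>A = _\<close>)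
    then show ?case using Ioo by simp
  next
    case empty
    then show ?case by (simp add: set_lebesgue_integral_def)
  next
    case (compl A)
    then have A: "A \<in> sets borel" by (simp only: borel)
    have "set_lebesgue_integral unit_interval ({0..1}) k = (LINT t|unit_interval. indicator {-1<..<2} t * k t)"
      unfolding set_lebesgue_integral_def
      by (rule Bochner_Integration.integral_cong) (auto simp: indicator_def)
    then have "set_lebesgue_integral unit_interval ({0..1}) k = 0" using Ioo by simp
    moreover have "set_lebesgue_integral unit_interval (((UNIV - A) \<inter> {0..1}) \<union> (A \<inter> {0..1})) k
       = set_lebesgue_integral unit_interval ((UNIV - A) \<inter> {0..1}) k + set_lebesgue_integral unit_interval (A \<inter> {0..1}) k"
      by (rule set_integral_Un) (use si A in auto)
    moreover have "((UNIV - A) \<inter> {0..1}) \<union> (A \<inter> {0..1}) = {0..1}" by auto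
    ultimately show ?case using compl by simp
  next
    case (union A)
    then have A: "A i \<in> sets borel" for i by (auto simp only: borel)
    have "set_lebesgue_integral unit_interval (\<Union>i. A i \<inter> {0..1}) k
        = (\<Sum>i. set_lebesgue_integral unit_interval (A i \<inter> {0..1}) k)"
    proof (rule lebesgue_integral_countable_add)
      show "A i \<inter> {0..1} \<in> sets unit_interval" for i using mem A by blast
      show "i \<noteq> j \<Longrightarrow> (A i \<inter> {0..1}) \<inter> (A j \<inter> {0..1}) = {}" for i j
        using union(1) by (auto simp: disjoint_family_on_def)
      have "(\<Union>i. A i \<inter> {0..1}) = (\<Union>i. A i) \<inter> {0..1}" by auto
      then show "set_integrable unit_interval (\<Union>i. A i \<inter> {0..1}) k"
        using si[of "\<Union>i. A i"] A by (simp add: sets.countable_UN)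
    qed
    also have "\<dots> = 0" using union by simp
    finally show ?case by simp
  qed
  then have "set_lebesgue_integral unit_interval (A \<inter> {0..1}) k = 0" if "A \<in> sets borel" for A
    using that by (simp only: borel)
  moreover have "\<exists>B\<in>sets borel. A = B \<inter> {0..1}" if "A \<in> sets unit_interval" for A
    using that by (auto simp: unit_interval_def sets_restrict_space)
  ultimately have "AE t in unit_interval. k t = 0"
    by (intro sigma_finite_measure.density_zero[OF _ ik] finite_measure.axioms(1)[OF finite_measure_unit_interval]) blast
  then show ?thesis by (simp add: k_def)
qed

lemma weak_deriv_L2: "f \<in> H1_interval \<Longrightarrow> weak_deriv f \<in> L2_interval"
  and is_weak_deriv_weak_deriv: "f \<in> H1_interval \<Longrightarrow> is_weak_deriv f (weak_deriv f)"
  using someI_ex[of "\<lambda>g. g \<in> L2_interval \<and> is_weak_deriv f g"]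
  unfolding H1_interval_def weak_deriv_def by auto

text \<open>
  This identifies the arbitrarily chosen representative \<open>weak_deriv f\<close> with any weak derivative that is
  at hand.
\<close>

lemma weak_deriv_AE_eq:
  assumes f: "continuous_on {0..1} f" and g: "g \<in> L2_interval" "is_weak_deriv f g"
  shows "f \<in> H1_interval" "AE t in unit_interval. weak_deriv f t = g t"
    "(LINT t|unit_interval. (weak_deriv f t)\<^sup>2) = (LINT t|unit_interval. (g t)\<^sup>2)"
proof -
  show H: "f \<in> H1_interval"
    using f g continuous_L2_interval by (auto simp: H1_interval_def)
  show ae: "AE t in unit_interval. weak_deriv f t = g t"
    by (rule weak_deriv_unique[OF f weak_deriv_L2[OF H] is_weak_deriv_weak_deriv[OF H] g])
  show "(LINT t|unit_interval. (weak_deriv f t)\<^sup>2) = (LINT t|unit_interval. (g t)\<^sup>2)"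
  proof (rule integral_cong_AE)
    show "AE t in unit_interval. (weak_deriv f t)\<^sup>2 = (g t)\<^sup>2" using ae by eventually_elim simp
    show "(\<lambda>t. (weak_deriv f t)\<^sup>2) \<in> borel_measurable unit_interval" "(\<lambda>t. (g t)\<^sup>2) \<in> borel_measurable unit_interval"
      using weak_deriv_L2[OF H] g by (auto simp: L2_interval_def)
  qed
qed

lemma weak_deriv_scale:
  assumes f: "continuous_on {0..1} f" "f \<in> H1_interval"
  shows "(\<lambda>t. c * f t) \<in> H1_interval"
    "(LINT t|unit_interval. (weak_deriv (\<lambda>t. c * f t) t)\<^sup>2) = c\<^sup>2 * (LINT t|unit_interval. (weak_deriv f t)\<^sup>2)"
proof -
  let ?g = "\<lambda>t. c * weak_deriv f t"
  have c: "continuous_on {0..1} (\<lambda>t. c * f t)" by (intro continuous_intros f)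
  have L: "?g \<in> L2_interval"
    using weak_deriv_L2[OF f(2)] by (auto simp: L2_interval_def power_mult_distrib)
  have w: "is_weak_deriv (\<lambda>t. c * f t) ?g"
    using is_weak_deriv_weak_deriv[OF f(2)] unfolding is_weak_deriv_def
    by (simp add: mult.assoc)
  note * = weak_deriv_AE_eq[OF c L w]
  show "(\<lambda>t. c * f t) \<in> H1_interval" by (rule *)
  show "(LINT t|unit_interval. (weak_deriv (\<lambda>t. c * f t) t)\<^sup>2) = c\<^sup>2 * (LINT t|unit_interval. (weak_deriv f t)\<^sup>2)"
    unfolding *(3) by (simp add: power_mult_distrib)
qed

text \<open>
  Integration by parts; the boundary terms vanish because test functions vanish at 0 and 1.
\<close>

lemma C1_is_weak_deriv:
  assumes f: "\<And>t. (f has_real_derivative g t) (at t)" and g: "continuous_on UNIV g"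
  shows "is_weak_deriv f g"
  unfolding is_weak_deriv_def
proof (intro allI impI)
  fix \<phi> :: "real \<Rightarrow> real"
  assume "\<phi> C1_differentiable_on UNIV \<and> closure {x. \<phi> x \<noteq> 0} \<subseteq> {0<..<1}"
  then obtain D where D: "\<And>t. (\<phi> has_real_derivative D t) (at t)" "continuous_on UNIV D"
    and supp: "closure {x. \<phi> x \<noteq> 0} \<subseteq> {0<..<1}"
    by (auto simp: C1_differentiable_on_def has_real_derivative_iff_has_vector_derivative)
  have z: "\<phi> 0 = 0" "\<phi> 1 = 0" using supp closure_subset[of "{x. \<phi> x \<noteq> 0}"] by auto
  have deriv: "deriv \<phi> = D" using D(1) by (auto intro: DERIV_imp_deriv)
  have cf: "continuous_on A f" for A using f by (meson DERIV_isCont continuous_at_imp_continuous_on)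
  have cp: "continuous_on A \<phi>" for A using D(1) by (meson DERIV_isCont continuous_at_imp_continuous_on)
  have cD: "continuous_on A D" and cg: "continuous_on A g" for A
    using D(2) g continuous_on_subset by auto
  have i: "integrable unit_interval (\<lambda>t. f t * D t)" "integrable unit_interval (\<lambda>t. g t * \<phi> t)"
    unfolding integrable_unit_interval real_scaleR_def[symmetric]
    by (intro borel_integrable_compact continuous_intros cf cp cD cg compact_Icc)+
  have "(LINT t|unit_interval. f t * D t) + (LINT t|unit_interval. g t * \<phi> t)
      = (LINT t|unit_interval. f t * D t + g t * \<phi> t)"
    by (rule Bochner_Integration.integral_add[symmetric]) (rule i)+
  also have "\<dots> = (LINT t|lborel. (f t * D t + g t * \<phi> t) * indicator {0..1} t)"
    unfolding integral_unit_interval by (simp add: mult.commute)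
  also have "\<dots> = f 1 * \<phi> 1 - f 0 * \<phi> 0"
  proof (rule integral_FTC_Icc_real)
    show "((\<lambda>t. f t * \<phi> t) has_real_derivative f t * D t + g t * \<phi> t) (at t)" for t
      by (rule derivative_eq_intros f D(1) refl)+ simp
    have "continuous_on UNIV (\<lambda>t. f t * D t + g t * \<phi> t)"
      by (intro continuous_intros cf cp cD cg)
    then show "isCont (\<lambda>t. f t * D t + g t * \<phi> t) t" for t
      by (simp add: continuous_on_eq_continuous_at)
  qed simp
  finally show "(LINT x|unit_interval. f x * deriv \<phi> x) = - (LINT x|unit_interval. g x * \<phi> x)"
    by (simp add: z deriv)
qed

section \<open>Sobolev functions on a graph with countably many edges\<close>

abbreviation edge_mass :: "('e \<times> real \<Rightarrow> real) \<Rightarrow> 'e \<Rightarrow> real" where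
  "edge_mass u e \<equiv> LINT x|unit_interval. (u (e, x))\<^sup>2"

abbreviation edge_dirichlet :: "('e \<times> real \<Rightarrow> real) \<Rightarrow> 'e \<Rightarrow> real" where
  "edge_dirichlet u e \<equiv> LINT x|unit_interval. (weak_deriv (\<lambda>t. u (e, t)) x)\<^sup>2"

abbreviation mass :: "('v, 'e) unit_graph \<Rightarrow> ('e \<times> real \<Rightarrow> real) \<Rightarrow> real" where
  "mass G u \<equiv> LINT z|length_measure G. (u z)\<^sup>2"

abbreviation dirichlet :: "('v, 'e) unit_graph \<Rightarrow> ('e \<times> real \<Rightarrow> real) \<Rightarrow> real" where
  "dirichlet G u \<equiv> LINT z|length_measure G. (edge_deriv u z)\<^sup>2"

lemma integrable_count_space_iff_summable_on:
  fixes f :: "'a \<Rightarrow> real"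
  shows "integrable (count_space A) f \<longleftrightarrow> f summable_on A"
  unfolding summable_on_iff_abs_summable_on_real[of f] abs_summable_equivalent abs_summable_on_def ..

lemma integral_count_space_eq_infsum:
  fixes f :: "'a \<Rightarrow> real"
  assumes "f summable_on A"
  shows "integral\<^sup>L (count_space A) f = infsum f A"
proof -
  have "Infinite_Set_Sum.abs_summable_on f A"
    using assms unfolding abs_summable_on_def integrable_count_space_iff_summable_on .
  then show ?thesis
    using infsetsum_infsum[of f A] by (simp add: infsetsum_def)
qed

text \<open>
  As there are countably many edges, the length measure is a product of sigma-finite measures, and
  Fubini's theorem turns integrals over the graph into sums over edges of integrals over \<open>[0,1]\<close>.
\<close>

context
  fixes G :: "('v, 'e) unit_graph"
  assumes countable: "countable (edges G)"
begin

lemma pair_sigma_finite_length_measure: "pair_sigma_finite (count_space (edges G)) unit_interval"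
  using countable finite_measure.axioms(1)[OF finite_measure_unit_interval]
  by (intro pair_sigma_finite.intro sigma_finite_measure_count_space_countable)

lemma length_measure_integrable_iff:
  fixes F :: "'e \<times> real \<Rightarrow> real"
  assumes nonneg: "\<And>z. 0 \<le> F z" and meas: "F \<in> borel_measurable (length_measure G)"
  shows "integrable (length_measure G) F \<longleftrightarrow>
    (\<forall>e\<in>edges G. integrable unit_interval (\<lambda>x. F (e, x))) \<and> (\<lambda>e. LINT x|unit_interval. F (e, x)) summable_on edges G"
proof -
  interpret pair_sigma_finite "count_space (edges G)" unit_interval
    by (rule pair_sigma_finite_length_measure)
  show ?thesis
  proof safe
    assume "integrable (length_measure G) F"
    then have i: "integrable (count_space (edges G) \<Otimes>\<^sub>M unit_interval) F" by (simp add: length_measure_def)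
    show "integrable unit_interval (\<lambda>x. F (e, x))" if "e \<in> edges G" for e
      using AE_integrable_fst'[OF i] that by (simp add: AE_count_space)
    show "(\<lambda>e. LINT x|unit_interval. F (e, x)) summable_on edges G"
      using integrable_fst'[OF i] by (simp add: integrable_count_space_iff_summable_on)
  next
    assume "\<forall>e\<in>edges G. integrable unit_interval (\<lambda>x. F (e, x))"
      and "(\<lambda>e. LINT x|unit_interval. F (e, x)) summable_on edges G"
    then show "integrable (length_measure G) F"
      unfolding length_measure_def using meas nonneg
      by (intro Fubini_integrable)
         (auto simp: length_measure_def AE_count_space integrable_count_space_iff_summable_on)
  qed
qed

lemma length_measure_integral:
  fixes F :: "'e \<times> real \<Rightarrow> real"
  assumes "integrable (length_measure G) F"
  shows "(\<lambda>e. LINT x|unit_interval. F (e, x)) summable_on edges G"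
    "integral\<^sup>L (length_measure G) F = (\<Sum>\<^sub>\<infinity>e\<in>edges G. LINT x|unit_interval. F (e, x))"
proof -
  interpret pair_sigma_finite "count_space (edges G)" unit_interval
    by (rule pair_sigma_finite_length_measure)
  have i: "integrable (count_space (edges G) \<Otimes>\<^sub>M unit_interval) F"
    using assms by (simp add: length_measure_def)
  show s: "(\<lambda>e. LINT x|unit_interval. F (e, x)) summable_on edges G"
    using integrable_fst'[OF i] by (simp add: integrable_count_space_iff_summable_on)
  show "integral\<^sup>L (length_measure G) F = (\<Sum>\<^sub>\<infinity>e\<in>edges G. LINT x|unit_interval. F (e, x))"
    using integral_fst'[OF i] integral_count_space_eq_infsum[OF s] by (simp add: length_measure_def)
qed

lemma borel_measurable_length_measureI:
  fixes F :: "'e \<times> real \<Rightarrow> real"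
  assumes "\<And>e. e \<in> edges G \<Longrightarrow> (\<lambda>x. F (e, x)) \<in> borel_measurable unit_interval"
  shows "F \<in> borel_measurable (length_measure G)"
  unfolding length_measure_def using countable assms by (rule measurable_pair_measure_countable1)

lemma H1_interval_integrable:
  assumes "f \<in> H1_interval"
  shows "integrable unit_interval (\<lambda>x. (f x)\<^sup>2)" "integrable unit_interval (\<lambda>x. (weak_deriv f x)\<^sup>2)"
  using assms weak_deriv_L2[OF assms] by (auto simp: H1_interval_def L2_interval_def)

lemma H1_measurable:
  assumes "\<And>e. e \<in> edges G \<Longrightarrow> (\<lambda>x. u (e, x)) \<in> H1_interval"
  shows "u \<in> borel_measurable (length_measure G)" "edge_deriv u \<in> borel_measurable (length_measure G)"
proof -
  show "u \<in> borel_measurable (length_measure G)"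
    using assms by (intro borel_measurable_length_measureI) (auto simp: H1_interval_def L2_interval_def)
  show "edge_deriv u \<in> borel_measurable (length_measure G)"
    using weak_deriv_L2[OF assms]
    by (intro borel_measurable_length_measureI) (auto simp: edge_deriv_def L2_interval_def)
qed

text \<open>
  Membership in terms of the two edgewise sums; in this form it can be checked one edge at a time.
\<close>

lemma H1_iff:
  "u \<in> H1 G \<longleftrightarrow> graph_continuous G u \<and> (\<forall>e\<in>edges G. (\<lambda>x. u (e, x)) \<in> H1_interval) \<and>
     edge_mass u summable_on edges G \<and> edge_dirichlet u summable_on edges G" (is "_ \<longleftrightarrow> ?R")
proof -
  have "integrable (length_measure G) (\<lambda>z. (edge_deriv u z)\<^sup>2 + (u z)\<^sup>2) \<longleftrightarrow>
      edge_mass u summable_on edges G \<and> edge_dirichlet u summable_on edges G"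
    if H: "\<And>e. e \<in> edges G \<Longrightarrow> (\<lambda>x. u (e, x)) \<in> H1_interval"
  proof -
    note m = H1_measurable[OF H, simplified]
    have "integrable (length_measure G) (\<lambda>z. (edge_deriv u z)\<^sup>2 + (u z)\<^sup>2) \<longleftrightarrow>
      integrable (length_measure G) (\<lambda>z. (u z)\<^sup>2) \<and> integrable (length_measure G) (\<lambda>z. (edge_deriv u z)\<^sup>2)"
    proof safe
      assume i: "integrable (length_measure G) (\<lambda>z. (edge_deriv u z)\<^sup>2 + (u z)\<^sup>2)"
      show "integrable (length_measure G) (\<lambda>z. (u z)\<^sup>2)"
        by (rule Bochner_Integration.integrable_bound[OF i]) (use m in auto)
      show "integrable (length_measure G) (\<lambda>z. (edge_deriv u z)\<^sup>2)"
        by (rule Bochner_Integration.integrable_bound[OF i]) (use m in auto)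
    qed simp
    also have "integrable (length_measure G) (\<lambda>z. (u z)\<^sup>2) \<longleftrightarrow> edge_mass u summable_on edges G"
      using H1_interval_integrable[OF H] m by (subst length_measure_integrable_iff) auto
    also have "integrable (length_measure G) (\<lambda>z. (edge_deriv u z)\<^sup>2) \<longleftrightarrow> edge_dirichlet u summable_on edges G"
      using H1_interval_integrable[OF H] m by (subst length_measure_integrable_iff) (auto simp: edge_deriv_def)
    finally show ?thesis .
  qed
  then show ?thesis unfolding H1_def by auto
qed

lemma H1D:
  assumes "u \<in> H1 G"
  shows "e \<in> edges G \<Longrightarrow> continuous_on {0..1} (\<lambda>x. u (e, x))"
    "e \<in> edges G \<Longrightarrow> (\<lambda>x. u (e, x)) \<in> H1_interval"
    "edge_mass u summable_on edges G" "edge_dirichlet u summable_on edges G"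
  using assms unfolding H1_iff graph_continuous_def by auto

lemma H1_integrable:
  assumes "u \<in> H1 G"
  shows "integrable (length_measure G) (\<lambda>z. (u z)\<^sup>2)" "integrable (length_measure G) (\<lambda>z. (edge_deriv u z)\<^sup>2)"
proof -
  note H = H1D(2)[OF assms]
  note m = H1_measurable[OF H, simplified]
  show "integrable (length_measure G) (\<lambda>z. (u z)\<^sup>2)"
    using H1_interval_integrable[OF H] m H1D(3)[OF assms] by (subst length_measure_integrable_iff) auto
  show "integrable (length_measure G) (\<lambda>z. (edge_deriv u z)\<^sup>2)"
    using H1_interval_integrable[OF H] m H1D(4)[OF assms]
    by (subst length_measure_integrable_iff) (auto simp: edge_deriv_def)
qed

lemma mass_eq_infsum: "u \<in> H1 G \<Longrightarrow> mass G u = infsum (edge_mass u) (edges G)"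
  using length_measure_integral(2)[OF H1_integrable(1)] by simp

lemma dirichlet_eq_infsum: "u \<in> H1 G \<Longrightarrow> dirichlet G u = infsum (edge_dirichlet u) (edges G)"
  using length_measure_integral(2)[OF H1_integrable(2)] by (simp add: edge_deriv_def)

lemma edge_le_total:
  assumes u: "u \<in> H1 G" and e: "e \<in> edges G"
  shows "edge_mass u e \<le> mass G u" "edge_dirichlet u e \<le> dirichlet G u"
proof -
  have *: "f e \<le> infsum f (edges G)" if "f summable_on edges G" "\<And>e. 0 \<le> f e" for f :: "'e \<Rightarrow> real"
    using finite_sum_le_infsum[OF that(1), of "{e}"] that(2) e by simp
  show "edge_mass u e \<le> mass G u" "edge_dirichlet u e \<le> dirichlet G u"
    unfolding mass_eq_infsum[OF u] dirichlet_eq_infsum[OF u] by (rule *; use H1D[OF u] in simp)+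
qed

lemma H1_square_le:
  assumes u: "u \<in> H1 G" and e: "e \<in> edges G" and x: "x \<in> {0..1}" and h: "0 < h" "h \<le> 1"
  shows "(u (e, x))\<^sup>2 \<le> 2 / h * mass G u + 2 * h * dirichlet G u"
proof -
  have "(u (e, x))\<^sup>2 \<le> 2 / h * edge_mass u e + 2 * h * edge_dirichlet u e"
    using H1D(1,2)[OF u e] x h
    by (intro point_le_average[of "\<lambda>t. u (e, t)"] weak_deriv_L2 is_weak_deriv_weak_deriv)
  also have "\<dots> \<le> 2 / h * mass G u + 2 * h * dirichlet G u"
    using edge_le_total[OF u e] h by (intro add_mono mult_left_mono) auto
  finally show ?thesis .
qed

lemma H1_scale:
  assumes u: "u \<in> H1 G"
  shows "(\<lambda>z. c * u z) \<in> H1 G" "mass G (\<lambda>z. c * u z) = c\<^sup>2 * mass G u"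
    "dirichlet G (\<lambda>z. c * u z) = c\<^sup>2 * dirichlet G u"
proof -
  have D: "edge_dirichlet (\<lambda>z. c * u z) e = c\<^sup>2 * edge_dirichlet u e" if "e \<in> edges G" for e
    using weak_deriv_scale(2)[OF H1D(1,2)[OF u that]] by simp
  have "edge_dirichlet (\<lambda>z. c * u z) summable_on edges G"
    using summable_on_cmult_right[OF H1D(4)[OF u]] D by (simp cong: summable_on_cong)
  moreover have "edge_mass (\<lambda>z. c * u z) summable_on edges G"
    using summable_on_cmult_right[OF H1D(3)[OF u]] by (simp add: power_mult_distrib)
  moreover have "graph_continuous G (\<lambda>z. c * u z)"
  proof -
    obtain val where "\<forall>e \<in> edges G. u (e, 0) = val (tail G e) \<and> u (e, 1) = val (head G e)"
      using u by (auto simp: H1_iff graph_continuous_def)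
    then show ?thesis
      using H1D(1)[OF u] unfolding graph_continuous_def
      by (auto intro!: continuous_intros exI[of _ "\<lambda>v. c * val v"])
  qed
  ultimately show H: "(\<lambda>z. c * u z) \<in> H1 G"
    using weak_deriv_scale(1)[OF H1D(1,2)[OF u]] by (auto simp: H1_iff)
  show "mass G (\<lambda>z. c * u z) = c\<^sup>2 * mass G u"
    by (simp add: power_mult_distrib)
  show "dirichlet G (\<lambda>z. c * u z) = c\<^sup>2 * dirichlet G u"
    unfolding dirichlet_eq_infsum[OF H] dirichlet_eq_infsum[OF u]
    using D by (simp add: infsum_cmult_right' cong: infsum_cong)
qed

text \<open>
  If the mass vanished, the pointwise estimate \<open>H1_square_le\<close> would leave only the term \<open>2 * h * D\<close>, where
  \<open>D\<close> is the Dirichlet integral, and that is arbitrarily small.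
\<close>

lemma mass_pos:
  assumes u: "u \<in> H1 G" and z: "z \<in> points G" "u z \<noteq> 0"
  shows "0 < mass G u"
proof -
  obtain e x where ex: "z = (e, x)" "e \<in> edges G" "x \<in> {0..1}" using z by (auto simp: points_def)
  define c where "c = (u z)\<^sup>2"
  have c: "c > 0" using z by (simp add: c_def)
  show ?thesis
  proof (rule ccontr)
    assume "\<not> 0 < mass G u"
    moreover have "0 \<le> mass G u" by simp
    ultimately have m: "mass G u = 0" by linarith
    have D: "0 \<le> dirichlet G u" by simp
    define h where "h = min 1 (c / (4 * dirichlet G u + 1))"
    have h: "0 < h" "h \<le> 1" using c D by (auto simp: h_def add_nonneg_pos)
    have "h \<le> c / (4 * dirichlet G u + 1)" by (simp add: h_def)
    moreover have "0 < 4 * dirichlet G u + 1" using D by linarith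
    ultimately have "h * (4 * dirichlet G u + 1) \<le> c" by (simp add: pos_le_divide_eq)
    have "c \<le> 2 * h * dirichlet G u"
      using H1_square_le[OF u ex(2,3) h] m by (simp add: c_def ex)
    then show False
      using \<open>h * (4 * dirichlet G u + 1) \<le> c\<close> h mult_nonneg_nonneg[OF less_imp_le[OF h(1)] D]
      by (simp add: algebra_simps)
  qed
qed

end

section \<open>Poincare and Gagliardo-Nirenberg inequalities on binary trees\<close>

lemma branches_sel [simp]:
  "edges (branches k) = {..<k} \<times> UNIV" "tail (branches k) = parent" "head (branches k) = Some"
  by (simp_all add: branches_def)

lemma countable_edges_branches: "countable (edges (branches k))"
  by simp

lemma
  fixes f :: "nat \<times> bool list \<Rightarrow> real"
  shows summable_on_branches: "f summable_on {..<k} \<times> UNIV \<longleftrightarrow> (\<forall>i<k. (\<lambda>w. f (i, w)) summable_on UNIV)"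
    and infsum_branches: "(\<And>i. i < k \<Longrightarrow> (\<lambda>w. f (i, w)) summable_on UNIV) \<Longrightarrow>
      infsum f ({..<k} \<times> UNIV) = (\<Sum>i<k. \<Sum>\<^sub>\<infinity>w. f (i, w))"
proof -
  have eq: "{..<k} \<times> UNIV = (\<Union>i\<in>{..<k}. Pair i ` (UNIV :: bool list set))" by auto
  have one: "f summable_on Pair i ` (UNIV :: bool list set) \<longleftrightarrow> (\<lambda>w. f (i, w)) summable_on UNIV"
    "infsum f (Pair i ` (UNIV :: bool list set)) = (\<Sum>\<^sub>\<infinity>w. f (i, w))" for i
    by (simp_all add: summable_on_reindex infsum_reindex inj_on_def o_def)
  show "f summable_on {..<k} \<times> UNIV \<longleftrightarrow> (\<forall>i<k. (\<lambda>w. f (i, w)) summable_on UNIV)"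
  proof
    assume f: "f summable_on {..<k} \<times> UNIV"
    show "\<forall>i<k. (\<lambda>w. f (i, w)) summable_on UNIV"
    proof (intro allI impI)
      fix i assume "i < k"
      then have "f summable_on Pair i ` (UNIV :: bool list set)"
        by (intro summable_on_subset_banach[OF f]) auto
      then show "(\<lambda>w. f (i, w)) summable_on UNIV" by (simp add: one)
    qed
  next
    assume "\<forall>i<k. (\<lambda>w. f (i, w)) summable_on UNIV"
    then show "f summable_on {..<k} \<times> UNIV"
      unfolding eq by (intro summable_on_finite_union_disjoint) (auto simp: one)
  qed
  assume "\<And>i. i < k \<Longrightarrow> (\<lambda>w. f (i, w)) summable_on UNIV"
  then show "infsum f ({..<k} \<times> UNIV) = (\<Sum>i<k. \<Sum>\<^sub>\<infinity>w. f (i, w))"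
    unfolding eq by (subst sum_infsum[symmetric]) (auto simp: one)
qed

text \<open>
  The expansion of the binary tree: each edge is followed by two edges that start where it ends. Hence
  among the tails of the edges every head occurs twice.
\<close>

lemma sum_heads_le_sum_tails:
  fixes g :: "(nat \<times> bool list) option \<Rightarrow> real"
  assumes nonneg: "\<And>v. 0 \<le> g v"
    and heads: "(\<lambda>e. g (Some e)) summable_on {..<k} \<times> UNIV"
    and tails: "(\<lambda>e. g (parent e)) summable_on {..<k} \<times> UNIV"
  shows "2 * (\<Sum>\<^sub>\<infinity>e\<in>{..<k} \<times> UNIV. g (Some e)) \<le> (\<Sum>\<^sub>\<infinity>e\<in>{..<k} \<times> UNIV. g (parent e))"
proof -
  define E where "E = {..<k} \<times> (UNIV :: bool list set)"
  define c where "c b e = (fst e, b # snd e)" for b and e :: "nat \<times> bool list"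
  have inj: "inj_on (c b) E" for b by (auto simp: inj_on_def c_def prod_eq_iff)
  have sub: "c b ` E \<subseteq> E" for b by (auto simp: c_def E_def)
  have s: "(\<lambda>e. g (parent e)) summable_on c b ` E" for b
    using tails sub unfolding E_def[symmetric] by (rule summable_on_subset_banach)
  have eq: "infsum (\<lambda>e. g (parent e)) (c b ` E) = (\<Sum>\<^sub>\<infinity>e\<in>E. g (Some e))" for b
    unfolding infsum_reindex[OF inj] by (simp add: o_def c_def)
  have "2 * (\<Sum>\<^sub>\<infinity>e\<in>E. g (Some e))
      = infsum (\<lambda>e. g (parent e)) (c True ` E) + infsum (\<lambda>e. g (parent e)) (c False ` E)"
    by (simp add: eq)
  also have "\<dots> = infsum (\<lambda>e. g (parent e)) (c True ` E \<union> c False ` E)"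
    by (rule infsum_Un_disjoint[symmetric]) (use s in \<open>auto simp: c_def\<close>)
  also have "\<dots> \<le> infsum (\<lambda>e. g (parent e)) E"
  proof (rule infsum_mono2)
    show "(\<lambda>e. g (parent e)) summable_on c True ` E \<union> c False ` E"
      by (rule summable_on_subset_banach[of _ E]) (use tails sub in \<open>auto simp: E_def\<close>)
  qed (use tails sub nonneg in \<open>auto simp: E_def\<close>)
  finally show ?thesis by (simp add: E_def)
qed

text \<open>
  Let \<open>T\<close> and \<open>R\<close> be the sums over all edges of \<open>u\<^sup>2\<close> at the tail and at the head, and \<open>D\<close> the
  Dirichlet integral. Along an edge \<open>u\<^sup>2\<close> changes little up to an error controlled by \<open>D\<close>, so
  \<open>T \<le> 3/2 * R + 3 * D\<close>, whereas the expansion of the tree gives \<open>2 * R \<le> T\<close>. The factor 3/2 is less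
  than 2, so these inequalities bound \<open>T\<close>, and with it the mass, by a multiple of \<open>D\<close>. Summability of
  the vertex values is what permits \<open>T\<close> to be absorbed.
\<close>

lemma poincare:
  assumes u: "u \<in> H1 (branches k)"
  shows "mass (branches k) u \<le> 26 * dirichlet (branches k) u"
proof -
  let ?E = "{..<k} \<times> (UNIV :: bool list set)"
  note ce = countable_edges_branches[of k]
  note H = H1D[OF ce u, simplified branches_sel]
  obtain val where val: "\<And>e. e \<in> ?E \<Longrightarrow> u (e, 0) = val (parent e)" "\<And>e. e \<in> ?E \<Longrightarrow> u (e, 1) = val (Some e)"
    using u by (auto simp: H1_iff[OF ce] graph_continuous_def)
  define M where "M = infsum (edge_mass u) ?E"
  define D where "D = infsum (edge_dirichlet u) ?E"
  define T where "T = (\<Sum>\<^sub>\<infinity>e\<in>?E. (val (parent e))\<^sup>2)"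
  define R where "R = (\<Sum>\<^sub>\<infinity>e\<in>?E. (val (Some e))\<^sup>2)"
  have endpt: "(u (e, x))\<^sup>2 \<le> 2 * edge_mass u e + 2 * edge_dirichlet u e" if "e \<in> ?E" "x \<in> {0..1}" for e x
    using point_le_average[OF H(1) weak_deriv_L2[OF H(2)] is_weak_deriv_weak_deriv[OF H(2)], of e x 1] that by simp
  have sMD: "(\<lambda>e. a * edge_mass u e + b * edge_dirichlet u e) summable_on ?E" for a b
    by (intro summable_on_add summable_on_cmult_right H)
  have sT: "(\<lambda>e. (val (parent e))\<^sup>2) summable_on ?E"
    by (rule summable_on_comparison_test[OF sMD[of 2 2]]) (use endpt[of _ 0] val(1) in auto)
  have sR: "(\<lambda>e. (val (Some e))\<^sup>2) summable_on ?E"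
    by (rule summable_on_comparison_test[OF sMD[of 2 2]]) (use endpt[of _ 1] val(2) in auto)
  have "2 * R \<le> T"
    unfolding R_def T_def by (rule sum_heads_le_sum_tails[OF _ sR sT]) simp
  have "T \<le> (\<Sum>\<^sub>\<infinity>e\<in>?E. 3 / 2 * (val (Some e))\<^sup>2 + 3 * edge_dirichlet u e)"
    unfolding T_def
  proof (rule infsum_mono[OF sT])
    show "(\<lambda>e. 3 / 2 * (val (Some e))\<^sup>2 + 3 * edge_dirichlet u e) summable_on ?E"
      by (intro summable_on_add summable_on_cmult_right sR H)
    fix e assume e: "e \<in> ?E"
    have "(u (e, 1) - u (e, 0))\<^sup>2 \<le> edge_dirichlet u e"
      using square_diff_le[OF H(1) weak_deriv_L2[OF H(2)] is_weak_deriv_weak_deriv[OF H(2)], of e 0 1] e by simp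
    moreover have "(u (e, 0))\<^sup>2 \<le> 3 / 2 * (u (e, 1))\<^sup>2 + 3 * (u (e, 1) - u (e, 0))\<^sup>2"
      using zero_le_power2[of "3 * u (e, 1) - 2 * u (e, 0)"] by (simp add: power2_eq_square algebra_simps)
    ultimately show "(val (parent e))\<^sup>2 \<le> 3 / 2 * (val (Some e))\<^sup>2 + 3 * edge_dirichlet u e"
      using val[OF e] by simp
  qed
  also have "\<dots> = 3 / 2 * R + 3 * D"
    unfolding R_def D_def
    by (simp only: infsum_add[OF summable_on_cmult_right[OF sR] summable_on_cmult_right[OF H(4)]] infsum_cmult_right')
  finally have "T \<le> 12 * D" using \<open>2 * R \<le> T\<close> by simp
  have "M \<le> (\<Sum>\<^sub>\<infinity>e\<in>?E. 2 * (val (parent e))\<^sup>2 + 2 * edge_dirichlet u e)"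
    unfolding M_def
  proof (rule infsum_mono[OF H(3)])
    show "(\<lambda>e. 2 * (val (parent e))\<^sup>2 + 2 * edge_dirichlet u e) summable_on ?E"
      by (intro summable_on_add summable_on_cmult_right sT H)
    fix e assume e: "e \<in> ?E"
    show "edge_mass u e \<le> 2 * (val (parent e))\<^sup>2 + 2 * edge_dirichlet u e"
      using average_le_point[OF H(1) weak_deriv_L2[OF H(2)] is_weak_deriv_weak_deriv[OF H(2)], of e 0] e val(1) by simp
  qed
  also have "\<dots> = 2 * T + 2 * D"
    unfolding T_def D_def
    by (simp only: infsum_add[OF summable_on_cmult_right[OF sT] summable_on_cmult_right[OF H(4)]] infsum_cmult_right')
  finally have "M \<le> 26 * D" using \<open>T \<le> 12 * D\<close> by simp
  then show ?thesis
    by (simp add: mass_eq_infsum[OF ce u] dirichlet_eq_infsum[OF ce u] M_def D_def)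
qed

text \<open>
  Balance of the two terms of \<open>H1_square_le\<close>, at \<open>h = 1 / (6 * sqrt D)\<close>. This is an admissible length,
  at most 1, because the Poincare inequality keeps the Dirichlet integral \<open>D\<close> away from 0.
\<close>

lemma sup_bound:
  assumes u: "u \<in> H1 (branches k)" and m: "mass (branches k) u = 1"
    and e: "e \<in> edges (branches k)" and x: "x \<in> {0..1}"
  shows "(u (e, x))\<^sup>2 \<le> 13 * sqrt (dirichlet (branches k) u)"
proof -
  define D where "D = dirichlet (branches k) u"
  have D: "1 \<le> 26 * D" using poincare[OF u] m by (simp add: D_def)
  define r where "r = sqrt D"
  have r: "D = r\<^sup>2" "0 < r" using D by (simp_all add: r_def)
  have "1 \<le> 6 * r"
  proof (rule ccontr)
    assume "\<not> 1 \<le> 6 * r"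
    then have "(6 * r)\<^sup>2 < 1\<^sup>2" using r by (intro power_strict_mono) auto
    then show False using D r by (simp add: power_mult_distrib)
  qed
  then have "(u (e, x))\<^sup>2 \<le> 2 / (1 / (6 * r)) * 1 + 2 * (1 / (6 * r)) * D"
    using H1_square_le[OF countable_edges_branches u e x, of "1 / (6 * r)"] r m by (simp add: D_def[symmetric])
  also have "\<dots> \<le> 13 * r" using r by (simp add: power2_eq_square)
  finally show ?thesis by (simp add: r_def D_def)
qed

text \<open>
  The Gagliardo-Nirenberg inequality at mass 1: \<open>p - 2\<close> of the \<open>p\<close> factors are estimated by the
  supremum, the other two by the mass. The power of the Dirichlet integral that appears is
  \<open>(p - 2) / 4\<close>, which is less than 1 precisely for \<open>p < 6\<close>.
\<close>

lemma potential_bound: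
  assumes u: "u \<in> H1 (branches k)" and m: "mass (branches k) u = 1" and p: "2 < p"
  shows "(LINT z|length_measure (branches k). \<bar>u z\<bar> powr p)
      \<le> 13 powr ((p - 2) / 2) * dirichlet (branches k) u powr ((p - 2) / 4)" (is ?bound)
    and "0 < (LINT z|length_measure (branches k). \<bar>u z\<bar> powr p)" (is ?pos)
proof -
  let ?M = "length_measure (branches k)"
  define D where "D = dirichlet (branches k) u"
  define K where "K = 13 powr ((p - 2) / 2) * D powr ((p - 2) / 4)"
  note ce = countable_edges_branches[of k]
  have i2: "integrable ?M (\<lambda>z. (u z)\<^sup>2)" using H1_integrable[OF ce u] by simp
  have mu: "u \<in> borel_measurable ?M"
    using H1_measurable[OF ce] H1D(2)[OF ce u] by blast
  have space: "z \<in> points (branches k)" if "z \<in> space ?M" for z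
    using that by (auto simp: length_measure_def space_pair_measure points_def)
  have le: "\<bar>u z\<bar> powr p \<le> K * (u z)\<^sup>2" if "z \<in> space ?M" for z
  proof (cases "u z = 0")
    case False
    obtain e x where z: "z = (e, x)" "e \<in> edges (branches k)" "x \<in> {0..1}"
      using space[OF \<open>z \<in> space ?M\<close>] by (auto simp: points_def)
    have "2 * ((p - 2) / 2) + 2 = p" by (simp add: field_simps)
    then have "\<bar>u z\<bar> powr p = \<bar>u z\<bar> powr (2 * ((p - 2) / 2) + 2)" by (simp only:)
    also have "\<dots> = (\<bar>u z\<bar> powr 2) powr ((p - 2) / 2) * \<bar>u z\<bar> powr 2"
      by (simp only: powr_add powr_powr)
    also have "\<bar>u z\<bar> powr 2 = (u z)\<^sup>2" using False by simp
    also have "((u z)\<^sup>2) powr ((p - 2) / 2) * (u z)\<^sup>2 \<le> (13 * sqrt D) powr ((p - 2) / 2) * (u z)\<^sup>2"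
      using sup_bound[OF u m z(2,3)] p by (intro mult_right_mono powr_mono2) (auto simp: D_def z)
    also have "(13 * sqrt D) powr ((p - 2) / 2) = K"
      by (simp add: K_def powr_mult D_def powr_half_sqrt[symmetric] powr_powr)
    finally show ?thesis .
  qed simp
  have ip: "integrable ?M (\<lambda>z. \<bar>u z\<bar> powr p)"
  proof (rule Bochner_Integration.integrable_bound)
    show "integrable ?M (\<lambda>z. K * (u z)\<^sup>2)" using i2 by simp
    show "(\<lambda>z. \<bar>u z\<bar> powr p) \<in> borel_measurable ?M" using mu by measurable
    show "AE z in ?M. norm (\<bar>u z\<bar> powr p) \<le> norm (K * (u z)\<^sup>2)"
    proof (rule AE_I2)
      fix z assume "z \<in> space ?M"
      from le[OF this] show "norm (\<bar>u z\<bar> powr p) \<le> norm (K * (u z)\<^sup>2)"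
        by (simp add: order_trans[OF _ abs_ge_self])
    qed
  qed
  have "(LINT z|?M. \<bar>u z\<bar> powr p) \<le> (LINT z|?M. K * (u z)\<^sup>2)"
    using ip i2 le by (intro integral_mono) auto
  also have "\<dots> = K" using m by simp
  finally show ?bound by (simp add: K_def D_def)
  show ?pos
  proof (rule ccontr)
    assume "\<not> ?pos"
    moreover have "0 \<le> (LINT z|?M. \<bar>u z\<bar> powr p)" by simp
    ultimately have "(LINT z|?M. \<bar>u z\<bar> powr p) = 0" by linarith
    then have "AE z in ?M. \<bar>u z\<bar> powr p = 0"
      using integral_nonneg_eq_0_iff_AE[OF ip] by simp
    then have "AE z in ?M. (u z)\<^sup>2 = 0" by eventually_elim simp
    then have "mass (branches k) u = 0" by (rule integral_eq_zero_AE)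
    then show False using m by simp
  qed
qed

section \<open>The bottom of the spectrum\<close>

text \<open>
  Branch \<open>i\<close> of the new tree carries the values of \<open>u\<close> on branch \<open>\<sigma> i\<close>. A constant \<open>\<sigma>\<close> either restricts
  \<open>u\<close> to one branch or, starting from a single branch, spreads copies of it over all branches.
\<close>

definition pull_branches :: "(nat \<Rightarrow> nat) \<Rightarrow> ((nat \<times> bool list) \<times> real \<Rightarrow> real) \<Rightarrow> (nat \<times> bool list) \<times> real \<Rightarrow> real" where
  "pull_branches \<sigma> u = (\<lambda>((i, w), x). u ((\<sigma> i, w), x))"

lemma pull_branches:
  assumes u: "u \<in> H1 (branches l)" and \<sigma>: "\<And>i. i < k \<Longrightarrow> \<sigma> i < l"
  shows "pull_branches \<sigma> u \<in> H1 (branches k)"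
    "mass (branches k) (pull_branches \<sigma> u) = (\<Sum>i<k. \<Sum>\<^sub>\<infinity>w. edge_mass u (\<sigma> i, w))"
    "dirichlet (branches k) (pull_branches \<sigma> u) = (\<Sum>i<k. \<Sum>\<^sub>\<infinity>w. edge_dirichlet u (\<sigma> i, w))"
proof -
  note H = H1D[OF countable_edges_branches u, simplified branches_sel]
  have m: "(\<lambda>w. edge_mass u (\<sigma> i, w)) summable_on UNIV"
    and d: "(\<lambda>w. edge_dirichlet u (\<sigma> i, w)) summable_on UNIV" if "i < k" for i
    using H(3,4) \<sigma>[OF that] unfolding summable_on_branches by auto
  obtain val where val: "\<And>e. e \<in> {..<l} \<times> UNIV \<Longrightarrow> u (e, 0) = val (parent e) \<and> u (e, 1) = val (Some e)"
    using u by (auto simp: H1_iff[OF countable_edges_branches] graph_continuous_def)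
  \<comment> \<open>The map of vertices that accompanies the map of edges fixes the common vertex None, where all branches are glued.\<close>
  have par: "map_option (\<lambda>(i, w). (\<sigma> i, w)) (parent (i, w)) = parent (\<sigma> i, w)" for i w
    by (cases w) auto
  have "graph_continuous (branches k) (pull_branches \<sigma> u)"
    unfolding graph_continuous_def
  proof (intro conjI ballI exI)
    fix e assume "e \<in> edges (branches k)"
    then obtain i w where e: "e = (i, w)" "i < k" by auto
    show "continuous_on {0..1} (\<lambda>x. pull_branches \<sigma> u (e, x))"
      using H(1)[of "(\<sigma> i, w)"] e \<sigma> by (simp add: pull_branches_def)
    show "pull_branches \<sigma> u (e, 0) = val (map_option (\<lambda>(i, w). (\<sigma> i, w)) (tail (branches k) e))"
      "pull_branches \<sigma> u (e, 1) = val (map_option (\<lambda>(i, w). (\<sigma> i, w)) (head (branches k) e))"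
      using val[of "(\<sigma> i, w)"] e \<sigma> par[of i w] by (auto simp: pull_branches_def)
  qed
  moreover have "(\<lambda>x. pull_branches \<sigma> u (e, x)) \<in> H1_interval" if "e \<in> {..<k} \<times> UNIV" for e
    using H(2)[of "(\<sigma> (fst e), snd e)"] that \<sigma> by (auto simp: pull_branches_def)
  ultimately show P: "pull_branches \<sigma> u \<in> H1 (branches k)"
    using m d unfolding H1_iff[OF countable_edges_branches]
    by (auto simp: summable_on_branches) (auto simp: pull_branches_def)
  show "mass (branches k) (pull_branches \<sigma> u) = (\<Sum>i<k. \<Sum>\<^sub>\<infinity>w. edge_mass u (\<sigma> i, w))"
    unfolding mass_eq_infsum[OF countable_edges_branches P] branches_sel
    by (subst infsum_branches) (use m in \<open>auto simp: pull_branches_def\<close>)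
  show "dirichlet (branches k) (pull_branches \<sigma> u) = (\<Sum>i<k. \<Sum>\<^sub>\<infinity>w. edge_dirichlet u (\<sigma> i, w))"
    unfolding dirichlet_eq_infsum[OF countable_edges_branches P] branches_sel
    by (subst infsum_branches) (use d in \<open>auto simp: pull_branches_def\<close>)
qed

lemma pull_branches_id:
  assumes u: "u \<in> H1 (branches k)"
  shows "mass (branches k) u = (\<Sum>i<k. \<Sum>\<^sub>\<infinity>w. edge_mass u (i, w))"
    "dirichlet (branches k) u = (\<Sum>i<k. \<Sum>\<^sub>\<infinity>w. edge_dirichlet u (i, w))"
proof -
  have "pull_branches (\<lambda>i. i) u = u" by (auto simp: pull_branches_def)
  then show "mass (branches k) u = (\<Sum>i<k. \<Sum>\<^sub>\<infinity>w. edge_mass u (i, w))"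
    "dirichlet (branches k) u = (\<Sum>i<k. \<Sum>\<^sub>\<infinity>w. edge_dirichlet u (i, w))"
    using pull_branches(2,3)[OF u, of k "\<lambda>i. i"] by auto
qed

text \<open>
  A parabola on one edge that vanishes at both ends extends by zero.
\<close>

lemma exists_nonzero_H1:
  assumes "0 < k" shows "\<exists>u \<in> H1 (branches k). \<exists>z \<in> points (branches k). u z \<noteq> 0"
proof -
  let ?e0 = "(0, []) :: nat \<times> bool list"
  define u where "u = (\<lambda>(e, x). if e = ?e0 then x * (1 - x) else (0::real))"
  define g where "g e x = (if e = ?e0 then 1 - 2 * x else (0::real))" for e :: "nat \<times> bool list" and x :: real
  have ct: "continuous_on {0..1} (\<lambda>x. u (e, x))" for e
    by (cases "e = ?e0") (auto simp: u_def intro!: continuous_intros)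
  have cg: "continuous_on A (g e)" for A e
    by (cases "e = ?e0") (auto simp: g_def intro!: continuous_intros)
  have w: "is_weak_deriv (\<lambda>x. u (e, x)) (g e)" for e
    by (rule C1_is_weak_deriv[OF _ cg]) (auto simp: u_def g_def intro!: derivative_eq_intros)
  note props = weak_deriv_AE_eq[OF ct continuous_L2_interval[OF cg] w]
  have e0: "?e0 \<in> {..<k} \<times> UNIV" using assms by simp
  have s: "f summable_on {..<k} \<times> UNIV" if "\<And>e. e \<noteq> ?e0 \<Longrightarrow> f e = 0" for f :: "nat \<times> bool list \<Rightarrow> real"
  proof -
    have "f summable_on {..<k} \<times> UNIV \<longleftrightarrow> f summable_on {?e0}"
      by (rule summable_on_cong_neutral) (use that e0 in auto)
    then show ?thesis by simp
  qed
  have "edge_mass u summable_on {..<k} \<times> UNIV"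
    by (rule s) (simp add: u_def)
  moreover have "edge_dirichlet u summable_on {..<k} \<times> UNIV"
    by (rule s) (simp only: props(3), simp add: g_def)
  moreover have "graph_continuous (branches k) u"
    unfolding graph_continuous_def using ct by (auto simp: u_def intro!: exI[of _ "\<lambda>_. 0"])
  ultimately have "u \<in> H1 (branches k)"
    using props(1) by (auto simp: H1_iff[OF countable_edges_branches])
  moreover have "(?e0, 1/2) \<in> points (branches k)" "u (?e0, 1/2) \<noteq> 0"
    using assms by (auto simp: points_def u_def)
  ultimately show ?thesis by blast
qed

lemma rayleigh_ge:
  assumes u: "u \<in> H1 (branches k)" "z \<in> points (branches k)" "u z \<noteq> 0"
  shows "1 / 26 \<le> dirichlet (branches k) u / mass (branches k) u"
  using poincare[OF u(1)] mass_pos[OF countable_edges_branches u] by (simp add: field_simps)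

lemma rayleigh_inf_lower:
  assumes "0 < k" shows "1 / 26 \<le> rayleigh_inf (branches k)"
  unfolding rayleigh_inf_def
  by (rule cINF_greatest) (use exists_nonzero_H1[OF assms] rayleigh_ge in auto)

lemma rayleigh_inf_le:
  assumes u: "u \<in> H1 (branches k)"
  shows "rayleigh_inf (branches k) * mass (branches k) u \<le> dirichlet (branches k) u"
proof (cases "\<exists>z \<in> points (branches k). u z \<noteq> 0")
  case True
  then obtain z where z: "z \<in> points (branches k)" "u z \<noteq> 0" by blast
  have "rayleigh_inf (branches k) \<le> dirichlet (branches k) u / mass (branches k) u"
    unfolding rayleigh_inf_def
    by (rule cINF_lower) (use rayleigh_ge True u in \<open>auto intro!: bdd_belowI[of _ "1/26"]\<close>)
  then show ?thesis using mass_pos[OF countable_edges_branches u z] by (simp add: pos_le_divide_eq)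
next
  case False
  have "mass (branches k) u = (LINT z|length_measure (branches k). 0)"
    by (rule Bochner_Integration.integral_cong)
       (use False in \<open>auto simp: length_measure_def space_pair_measure points_def\<close>)
  then show ?thesis by simp
qed

text \<open>
  Cutting a function at the common vertex gives one function on each branch, with additive mass and
  Dirichlet integral, so the quotient of the whole is at least the infimum for one branch. Conversely,
  copies of one function on all branches agree at the common vertex and leave its quotient unchanged.
\<close>

lemma rayleigh_inf_branches:
  assumes "0 < k" shows "rayleigh_inf (branches k) = rayleigh_inf (branches 1)"
proof (rule antisym)
  show "rayleigh_inf (branches 1) \<le> rayleigh_inf (branches k)"
    unfolding rayleigh_inf_def[of "branches k"]
  proof (rule cINF_greatest)
    show "{u \<in> H1 (branches k). \<exists>z\<in>points (branches k). u z \<noteq> 0} \<noteq> {}"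
      using exists_nonzero_H1[OF assms] by blast
    fix u assume "u \<in> {u \<in> H1 (branches k). \<exists>z\<in>points (branches k). u z \<noteq> 0}"
    then obtain z where u: "u \<in> H1 (branches k)" and z: "z \<in> points (branches k)" "u z \<noteq> 0" by blast
    have "rayleigh_inf (branches 1) * (\<Sum>\<^sub>\<infinity>w. edge_mass u (i, w)) \<le> (\<Sum>\<^sub>\<infinity>w. edge_dirichlet u (i, w))"
      if "i < k" for i
      using rayleigh_inf_le[OF pull_branches(1)[OF u, of 1 "\<lambda>_. i"]] pull_branches(2,3)[OF u, of 1 "\<lambda>_. i"] that
      by simp
    then have "(\<Sum>i<k. rayleigh_inf (branches 1) * (\<Sum>\<^sub>\<infinity>w. edge_mass u (i, w))) \<le> (\<Sum>i<k. \<Sum>\<^sub>\<infinity>w. edge_dirichlet u (i, w))"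
      by (intro sum_mono) auto
    then have "rayleigh_inf (branches 1) * mass (branches k) u \<le> dirichlet (branches k) u"
      unfolding pull_branches_id[OF u] by (simp only: sum_distrib_left)
    then show "rayleigh_inf (branches 1) \<le> dirichlet (branches k) u / mass (branches k) u"
      using mass_pos[OF countable_edges_branches u z] by (simp add: pos_le_divide_eq)
  qed
  show "rayleigh_inf (branches k) \<le> rayleigh_inf (branches 1)"
    unfolding rayleigh_inf_def[of "branches 1"]
  proof (rule cINF_greatest)
    show "{u \<in> H1 (branches 1). \<exists>z\<in>points (branches 1). u z \<noteq> 0} \<noteq> {}"
      using exists_nonzero_H1[OF zero_less_one] by blast
    fix u assume "u \<in> {u \<in> H1 (branches 1). \<exists>z\<in>points (branches 1). u z \<noteq> 0}"
    then obtain z where u: "u \<in> H1 (branches 1)" and z: "z \<in> points (branches 1)" "u z \<noteq> 0" by blast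
    have "real k * (rayleigh_inf (branches k) * mass (branches 1) u) \<le> real k * dirichlet (branches 1) u"
      using rayleigh_inf_le[OF pull_branches(1)[OF u, of k "\<lambda>_. 0"]] pull_branches(2,3)[OF u, of k "\<lambda>_. 0"]
        pull_branches_id[OF u] by (simp add: mult_ac)
    then have "rayleigh_inf (branches k) * mass (branches 1) u \<le> dirichlet (branches 1) u"
      using assms by simp
    then show "rayleigh_inf (branches k) \<le> dirichlet (branches 1) u / mass (branches 1) u"
      using mass_pos[OF countable_edges_branches u z] by (simp add: pos_le_divide_eq)
  qed
qed

section \<open>Infima of concave functions of the mass\<close>

lemma concave_on_chord:
  fixes f :: "real \<Rightarrow> real"
  assumes f: "concave_on S f" and xyz: "x \<in> S" "z \<in> S" "x < y" "y < z"
  shows "(z - y) * f x + (y - x) * f z \<le> (z - x) * f y"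
proof -
  define t where "t = (y - x) / (z - x)"
  have t: "0 \<le> t" "t \<le> 1" "t * (z - x) = y - x" "(1 - t) * (z - x) = z - y"
    using xyz by (auto simp: t_def field_simps)
  have "(1 - t) *\<^sub>R x + t *\<^sub>R z = x + t * (z - x)" by (simp add: algebra_simps)
  also have "\<dots> = y" using t by simp
  finally have "(1 - t) * f x + t * f z \<le> f y"
    using concave_onD[OF f t(1,2) xyz(1,2)] by simp
  then have "((1 - t) * f x + t * f z) * (z - x) \<le> f y * (z - x)"
    using xyz by (intro mult_right_mono) auto
  also have "((1 - t) * f x + t * f z) * (z - x) = ((1 - t) * (z - x)) * f x + (t * (z - x)) * f z"
    by (simp add: algebra_simps)
  finally show ?thesis unfolding t by (simp add: mult.commute)
qed

text \<open>
  Convexity of the power up to the endpoint 0, where it amounts to \<open>c powr q \<le> c\<close> for \<open>0 \<le> c \<le> 1\<close>.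
\<close>

lemma powr_convex_nonneg:
  fixes x y :: real
  assumes "1 \<le> q" "0 \<le> x" "0 \<le> y" "0 \<le> a" "0 \<le> b" "a + b = 1"
  shows "(a * x + b * y) powr q \<le> a * x powr q + b * y powr q"
proof -
  have scale: "(c * z) powr q \<le> c * z powr q" if "0 \<le> c" "c \<le> 1" "0 \<le> z" for c z :: real
  proof -
    have "c powr q \<le> c" using that \<open>1 \<le> q\<close> powr_mono'[of 1 q c] by simp
    then show ?thesis using that by (simp add: powr_mult mult_right_mono)
  qed
  consider "x = 0" | "y = 0" | "x > 0" "y > 0" using assms by linarith
  then show ?thesis
  proof cases
    case 1
    then show ?thesis using scale[of b y] assms by simp
  next
    case 2
    then show ?thesis using scale[of a x] assms by simp
  next
    case 3
    then show ?thesis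
      using powr_convex[OF \<open>1 \<le> q\<close>] assms by (simp add: convex_on_def)
  qed
qed

lemma concave_on_cINF:
  fixes f :: "'a \<Rightarrow> 'b::real_vector \<Rightarrow> real"
  assumes "S \<noteq> {}" "convex T" and f: "\<And>v. v \<in> S \<Longrightarrow> concave_on T (f v)"
    and bdd: "\<And>x. x \<in> T \<Longrightarrow> bdd_below ((\<lambda>v. f v x) ` S)"
  shows "concave_on T (\<lambda>x. INF v\<in>S. f v x)"
  unfolding concave_on_iff
proof (intro conjI ballI allI impI)
  fix x y and a b :: real
  assume xy: "x \<in> T" "y \<in> T" and ab: "0 \<le> a" "0 \<le> b" "a + b = 1"
  show "a * (INF v\<in>S. f v x) + b * (INF v\<in>S. f v y) \<le> (INF v\<in>S. f v (a *\<^sub>R x + b *\<^sub>R y))"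
  proof (rule cINF_greatest[OF \<open>S \<noteq> {}\<close>])
    fix v assume v: "v \<in> S"
    have "a * (INF v\<in>S. f v x) + b * (INF v\<in>S. f v y) \<le> a * f v x + b * f v y"
      using ab xy by (intro add_mono mult_left_mono cINF_lower bdd v) auto
    also have "\<dots> \<le> f v (a *\<^sub>R x + b *\<^sub>R y)"
      using f[OF v] xy ab by (simp add: concave_on_iff)
    finally show "a * (INF v\<in>S. f v x) + b * (INF v\<in>S. f v y) \<le> f v (a *\<^sub>R x + b *\<^sub>R y)" .
  qed
qed fact

text \<open>
  What remains of the variational problem once functions are normalised. Here \<open>S\<close> stands for the
  functions of mass 1, \<open>D\<close> for the Dirichlet integral, \<open>N\<close> for the nonlinear term and \<open>lam\<close> for the
  infimum of \<open>D\<close>; mass \<open>\<mu>\<close> enters only through the factors \<open>\<mu> / 2\<close> and \<open>\<mu> powr q\<close>, where \<open>q = p / 2\<close>.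
\<close>

locale nls_level =
  fixes S :: "'a set" and D N :: "'a \<Rightarrow> real" and L :: "real \<Rightarrow> real" and lam C \<alpha> q :: real
  assumes S: "S \<noteq> {}"
    and lam_pos: "0 < lam" and lam_le: "\<And>v. v \<in> S \<Longrightarrow> lam \<le> D v"
    and lam_approx: "\<And>\<epsilon>. 0 < \<epsilon> \<Longrightarrow> \<exists>v\<in>S. D v < lam + \<epsilon>"
    and N_pos: "\<And>v. v \<in> S \<Longrightarrow> 0 < N v" and N_le: "\<And>v. v \<in> S \<Longrightarrow> N v \<le> C * D v powr \<alpha>"
    and C: "0 < C" and \<alpha>: "0 < \<alpha>" "\<alpha> < 1" and q: "1 < q"
    and L_eq: "\<And>\<mu>. 0 \<le> \<mu> \<Longrightarrow> L \<mu> = (INF v\<in>S. \<mu> / 2 * D v - \<mu> powr q * N v)"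
begin

text \<open>
  As \<open>\<alpha> < 1\<close>, the term \<open>D powr \<alpha>\<close> is dominated by a small multiple of \<open>D\<close> once \<open>D\<close> is large.
\<close>

lemma bdd_below_energy:
  assumes "0 \<le> \<mu>" shows "bdd_below ((\<lambda>v. \<mu> / 2 * D v - \<mu> powr q * N v) ` S)"
proof (cases "\<mu> = 0")
  case True
  then show ?thesis by (auto simp: bdd_below_def)
next
  case False
  then have \<mu>: "0 < \<mu>" using assms by simp
  define B where "B = \<mu> powr q * C"
  have B: "0 < B" using \<mu> C by (simp add: B_def)
  \<comment> \<open>At D = K the bound B * D powr alpha for the nonlinear term equals the kinetic term.\<close>
  define K where "K = (2 * B / \<mu>) powr (1 / (1 - \<alpha>))"
  have K: "0 < K" using B \<mu> by (simp add: K_def)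
  have "K powr (1 - \<alpha>) = 2 * B / \<mu>"
    using \<alpha> B \<mu> by (simp add: K_def powr_powr)
  then have BK: "B = \<mu> / 2 * K powr (1 - \<alpha>)" using \<mu> by simp
  have "- (B * K powr \<alpha>) \<le> \<mu> / 2 * D v - \<mu> powr q * N v" if v: "v \<in> S" for v
  proof -
    have Dv: "0 < D v" using lam_pos lam_le[OF v] by simp
    have "\<mu> powr q * N v \<le> \<mu> powr q * (C * D v powr \<alpha>)"
      by (intro mult_left_mono N_le v) simp
    also have "\<dots> = B * D v powr \<alpha>" by (simp add: B_def)
    also have "\<dots> \<le> \<mu> / 2 * D v + B * K powr \<alpha>"
    proof (cases "D v \<le> K")
      case True
      then have "B * D v powr \<alpha> \<le> B * K powr \<alpha>" using Dv B \<alpha> by (intro mult_left_mono powr_mono2) auto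
      then show ?thesis using Dv \<mu> by (smt (verit) divide_pos_pos mult_pos_pos)
    next
      case False
      have "B * D v powr \<alpha> = \<mu> / 2 * (K powr (1 - \<alpha>) * D v powr \<alpha>)" by (subst BK) simp
      also have "\<dots> \<le> \<mu> / 2 * (D v powr (1 - \<alpha>) * D v powr \<alpha>)"
        using False K \<alpha> \<mu> by (intro mult_left_mono mult_right_mono powr_mono2) auto
      also have "D v powr (1 - \<alpha>) * D v powr \<alpha> = D v" using Dv by (simp flip: powr_add)
      finally show ?thesis using B by (simp add: add_increasing2)
    qed
    finally show ?thesis by simp
  qed
  then show ?thesis by (intro bdd_belowI[of _ "- (B * K powr \<alpha>)"]) auto
qed

lemma L_le:
  assumes "0 \<le> \<mu>" "v \<in> S" shows "L \<mu> \<le> \<mu> / 2 * D v - \<mu> powr q * N v"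
  unfolding L_eq[OF assms(1)] by (intro cINF_lower bdd_below_energy assms)

lemma L_0: "L 0 = 0"
  using S by (subst L_eq) auto

lemma L_concave: "concave_on {0..} L"
proof -
  have "concave_on {0..} (\<lambda>\<mu>. INF v\<in>S. \<mu> / 2 * D v - \<mu> powr q * N v)"
  proof (rule concave_on_cINF[OF S])
    show "bdd_below ((\<lambda>v. \<mu> / 2 * D v - \<mu> powr q * N v) ` S)" if "\<mu> \<in> {0..}" for \<mu>
      using that by (intro bdd_below_energy) auto
    fix v assume v: "v \<in> S"
    show "concave_on {0..} (\<lambda>\<mu>. \<mu> / 2 * D v - \<mu> powr q * N v)"
      unfolding concave_on_iff
    proof (intro conjI ballI allI impI)
      fix x y a b :: real
      assume xy: "x \<in> {0..}" "y \<in> {0..}" and ab: "0 \<le> a" "0 \<le> b" "a + b = 1"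
      have "(a * x + b * y) powr q * N v \<le> (a * x powr q + b * y powr q) * N v"
        using xy ab q N_pos[OF v] by (intro mult_right_mono powr_convex_nonneg) auto
      then show "a * (x / 2 * D v - x powr q * N v) + b * (y / 2 * D v - y powr q * N v)
          \<le> (a *\<^sub>R x + b *\<^sub>R y) / 2 * D v - (a *\<^sub>R x + b *\<^sub>R y) powr q * N v"
        by (simp add: algebra_simps add_divide_distrib)
    qed simp
  qed simp
  then show ?thesis
    unfolding concave_on_iff by (auto simp: L_eq)
qed

lemma L_le_linear:
  assumes "0 \<le> \<mu>" shows "L \<mu> \<le> 1 / 2 * lam * \<mu>"
proof (rule field_le_epsilon)
  fix \<epsilon> :: real assume "0 < \<epsilon>"
  define \<eta> where "\<eta> = \<epsilon> / (\<mu> + 1)"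
  have "0 < \<eta>" using \<open>0 < \<epsilon>\<close> assms by (simp add: \<eta>_def add_nonneg_pos)
  then obtain v where v: "v \<in> S" "D v < lam + \<eta>" using lam_approx by blast
  have "L \<mu> \<le> \<mu> / 2 * D v"
    using L_le[OF assms v(1)] mult_nonneg_nonneg[OF powr_ge_zero less_imp_le[OF N_pos[OF v(1)]], of \<mu> q] by simp
  also have "\<dots> \<le> \<mu> / 2 * (lam + \<eta>)" using v assms by (intro mult_left_mono) auto
  also have "\<dots> = 1 / 2 * lam * \<mu> + \<mu> * \<eta> / 2" by (simp add: algebra_simps)
  also have "\<mu> * \<eta> / 2 \<le> \<epsilon>"
  proof -
    have "\<mu> * \<eta> \<le> (\<mu> + 1) * \<eta>" using \<open>0 < \<eta>\<close> by (intro mult_right_mono) auto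
    also have "\<dots> = \<epsilon>" using assms by (simp add: \<eta>_def)
    finally show ?thesis using \<open>0 < \<epsilon>\<close> by simp
  qed
  finally show "L \<mu> \<le> 1 / 2 * lam * \<mu> + \<epsilon>" by simp
qed

text \<open>
  Since \<open>D\<close> is at least \<open>lam\<close>, also \<open>D powr \<alpha>\<close> is at most a multiple of \<open>D\<close>. The nonlinear term is
  therefore smaller than the kinetic one by a factor of order \<open>\<mu> powr (q - 1)\<close>, uniformly in the
  function.
\<close>

lemma L_lower:
  assumes "0 < \<mu>" and small: "C * lam powr (\<alpha> - 1) * \<mu> powr (q - 1) \<le> 1 / 2"
  shows "lam * \<mu> * (1 / 2 - C * lam powr (\<alpha> - 1) * \<mu> powr (q - 1)) \<le> L \<mu>"
proof -
  define C' where "C' = C * lam powr (\<alpha> - 1)"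
  have "lam * \<mu> * (1 / 2 - C' * \<mu> powr (q - 1)) \<le> (INF v\<in>S. \<mu> / 2 * D v - \<mu> powr q * N v)"
  proof (rule cINF_greatest[OF S])
    fix v assume v: "v \<in> S"
    have Dv: "0 < D v" using lam_pos lam_le[OF v] by simp
    have "N v \<le> C * (D v powr (\<alpha> - 1) * D v)"
      using N_le[OF v] Dv powr_add[of "D v" "\<alpha> - 1" 1] by simp
    also have "\<dots> \<le> C * (lam powr (\<alpha> - 1) * D v)"
      using Dv C \<alpha> lam_pos lam_le[OF v] by (intro mult_left_mono mult_right_mono powr_mono2') auto
    finally have "N v \<le> C' * D v" by (simp add: C'_def)
    have "lam * \<mu> * (1 / 2 - C' * \<mu> powr (q - 1)) \<le> D v * \<mu> * (1 / 2 - C' * \<mu> powr (q - 1))"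
      using assms lam_le[OF v] by (intro mult_right_mono) (auto simp: C'_def)
    also have "\<dots> = \<mu> / 2 * D v - \<mu> powr q * (C' * D v)"
      using \<open>0 < \<mu>\<close> powr_add[of \<mu> "q - 1" 1] by (simp add: algebra_simps)
    also have "\<dots> \<le> \<mu> / 2 * D v - \<mu> powr q * N v"
      using \<open>N v \<le> C' * D v\<close> by (intro diff_left_mono mult_left_mono) auto
    finally show "lam * \<mu> * (1 / 2 - C' * \<mu> powr (q - 1)) \<le> \<mu> / 2 * D v - \<mu> powr q * N v" .
  qed
  then show ?thesis using assms by (simp add: L_eq C'_def)
qed

lemma powr_at_right_0: "((\<lambda>\<mu>. C * lam powr (\<alpha> - 1) * \<mu> powr (q - 1)) \<longlongrightarrow> 0) (at_right 0)"
proof -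
  have "((\<lambda>\<mu>::real. \<mu> powr (q - 1)) \<longlongrightarrow> 0 powr (q - 1)) (at_right 0)"
    using q by (intro tendsto_powr' tendsto_intros tendsto_ident_at) (auto simp: eventually_at_filter)
  from tendsto_mult[OF tendsto_const this] show ?thesis by simp
qed

lemma small_mass: "\<forall>\<^sub>F \<mu> in at_right 0. 0 < \<mu> \<and> C * lam powr (\<alpha> - 1) * \<mu> powr (q - 1) < 1 / 4"
  using eventually_conj[OF eventually_at_right_less[of 0] order_tendstoD(2)[OF powr_at_right_0, of "1/4"]] by simp

lemma L_deriv: "(L has_real_derivative lam / 2) (at_right 0)"
proof -
  let ?e = "\<lambda>\<mu>. C * lam powr (\<alpha> - 1) * \<mu> powr (q - 1)"
  have "((\<lambda>\<mu>. L \<mu> / \<mu>) \<longlongrightarrow> lam / 2) (at_right 0)"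
  proof (rule tendsto_sandwich)
    show "\<forall>\<^sub>F \<mu> in at_right 0. lam * (1 / 2 - ?e \<mu>) \<le> L \<mu> / \<mu>"
      using small_mass
    proof eventually_elim
      case (elim \<mu>)
      then have "lam * \<mu> * (1 / 2 - ?e \<mu>) \<le> L \<mu>" by (intro L_lower) auto
      then show ?case using elim by (simp add: pos_le_divide_eq mult_ac)
    qed
    show "\<forall>\<^sub>F \<mu> in at_right 0. L \<mu> / \<mu> \<le> lam / 2"
      using small_mass
    proof eventually_elim
      case (elim \<mu>)
      then show ?case using L_le_linear[of \<mu>] by (simp add: pos_divide_le_eq mult_ac)
    qed
    show "((\<lambda>\<mu>. lam * (1 / 2 - ?e \<mu>)) \<longlongrightarrow> lam / 2) (at_right 0)"
      using tendsto_mult[OF tendsto_const[of lam] tendsto_diff[OF tendsto_const[of "1/2"] powr_at_right_0]] by simp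
  qed simp
  then show ?thesis by (simp add: has_field_derivative_iff L_0)
qed

text \<open>
  If \<open>L\<close> did not increase between \<open>x\<close> and \<open>y\<close>, concavity would prevent it from rising afterwards to the
  positive value \<open>L c\<close> at a fixed small \<open>c\<close>, whereas by \<open>L_le_linear\<close> all values close to 0 are below
  \<open>L c\<close>.
\<close>

lemma L_increasing_near_0:
  "\<exists>\<delta>>0. (\<forall>\<mu>\<in>{0<..\<delta>}. L \<mu> > 0) \<and> strict_mono_on {0..\<delta>} L"
proof -
  obtain b where b: "0 < b" "\<And>\<mu>. 0 < \<mu> \<Longrightarrow> \<mu> < b \<Longrightarrow> C * lam powr (\<alpha> - 1) * \<mu> powr (q - 1) < 1 / 4"
    using small_mass unfolding eventually_at_right_field by auto
  have pos: "0 < L \<mu>" if "0 < \<mu>" "\<mu> < b" for \<mu>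
  proof -
    have "0 < lam * \<mu> * (1 / 2 - C * lam powr (\<alpha> - 1) * \<mu> powr (q - 1))"
      using that b(2)[of \<mu>] lam_pos by (intro mult_pos_pos) auto
    also have "\<dots> \<le> L \<mu>" using that b(2)[of \<mu>] by (intro L_lower) auto
    finally show ?thesis .
  qed
  define c where "c = b / 2"
  have c: "0 < c" "c < b" "0 < L c" using b pos[of c] by (auto simp: c_def)
  define \<delta> where "\<delta> = min (c / 2) (L c / lam)"
  have \<delta>: "0 < \<delta>" "\<delta> < c" "\<delta> \<le> L c / lam" using c lam_pos by (auto simp: \<delta>_def)
  have below: "L y < L c" if "0 \<le> y" "y \<le> \<delta>" for y
  proof -
    have "y \<le> L c / lam" using that \<delta>(3) by simp
    then have "y * lam \<le> L c" using lam_pos by (simp add: pos_le_divide_eq)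
    then show ?thesis using L_le_linear[OF that(1)] c by (simp add: mult_ac)
  qed
  have "strict_mono_on {0..\<delta>} L"
  proof (rule strict_mono_onI)
    fix x y assume xy: "x \<in> {0..\<delta>}" "y \<in> {0..\<delta>}" "x < y"
    show "L x < L y"
    proof (rule ccontr)
      assume "\<not> L x < L y"
      have "(c - x) * L y = (c - y) * L y + (y - x) * L y" by (simp add: algebra_simps)
      also have "\<dots> < (c - y) * L x + (y - x) * L c"
        using \<open>\<not> L x < L y\<close> xy \<delta> below[of y] by (intro add_le_less_mono mult_left_mono mult_strict_left_mono) auto
      also have "\<dots> \<le> (c - x) * L y"
        using xy \<delta> by (intro concave_on_chord[OF L_concave]) auto
      finally show False by simp
    qed
  qed
  then show ?thesis using \<delta> c pos by (intro exI[of _ \<delta>]) auto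
qed

lemma L_eventually_negative: "\<exists>M. \<forall>\<mu>\<ge>M. L \<mu> < 0"
proof -
  obtain v where v: "v \<in> S" using S by blast
  have Dv: "0 < D v" using lam_pos lam_le[OF v] by simp
  \<comment> \<open>The mass at which the nonlinear term of v is twice the kinetic one.\<close>
  define M where "M = (D v / N v) powr (1 / (q - 1))"
  have M: "0 < M" "M powr (q - 1) = D v / N v"
    using Dv N_pos[OF v] q by (auto simp: M_def powr_powr)
  have "L \<mu> < 0" if "\<mu> \<ge> M" for \<mu>
  proof -
    have \<mu>: "0 < \<mu>" using that M by simp
    have "D v / N v \<le> \<mu> powr (q - 1)"
      unfolding M(2)[symmetric] using that M q by (intro powr_mono2) auto
    then have "D v \<le> \<mu> powr (q - 1) * N v"
      using N_pos[OF v] by (simp add: pos_divide_le_eq)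
    then have "\<mu> * D v \<le> \<mu> * (\<mu> powr (q - 1) * N v)"
      using \<mu> by (intro mult_left_mono) auto
    also have "\<dots> = \<mu> powr q * N v" using \<mu> powr_add[of \<mu> "q - 1" 1] by simp
    finally have "\<mu> / 2 * D v - \<mu> powr q * N v \<le> - (\<mu> * D v / 2)" by simp
    also have "\<dots> < 0" using \<mu> Dv by simp
    finally show ?thesis using L_le[of \<mu> v] \<mu> v by simp
  qed
  then show ?thesis by blast
qed

text \<open>
  A concave function is continuous in the interior of its domain; continuity at 0 comes from the
  derivative there.
\<close>

lemma L_continuous:
  assumes "0 < M" shows "continuous_on {0..M} L"
proof -
  have "convex_on {0<..} (\<lambda>x. - L x)"
    by (rule convex_on_subset[OF L_concave[unfolded concave_on_def]]) auto
  then have "continuous_on {0<..} (\<lambda>x. - L x)"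
    by (intro convex_on_continuous open_greaterThan)
  from continuous_on_minus[OF this] have cont: "continuous_on {0<..} L" by simp
  show ?thesis
    unfolding continuous_on_eq_continuous_within
  proof
    fix x assume x: "x \<in> {0..M}"
    show "continuous (at x within {0..M}) L"
    proof (cases "x = 0")
      case False
      then have "isCont L x"
        using cont x by (simp add: continuous_on_eq_continuous_at)
      then show ?thesis by (rule continuous_at_imp_continuous_at_within)
    next
      case True
      have "continuous (at_right 0) L"
        using L_deriv by (rule DERIV_continuous)
      then show ?thesis using True assms by (simp add: at_within_Icc_at_right)
    qed
  qed
qed

text \<open>
  Continuity and eventual negativity yield a maximum. The maximisers of a concave function may fill an
  interval, so the largest of them is taken: beyond it \<open>L\<close> is below the maximum, and by concavity a
  function that has started to descend goes on descending strictly.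
\<close>

lemma L_maximum:
  "\<exists>\<mu>bar>0. (\<forall>\<mu>\<ge>0. L \<mu> \<le> L \<mu>bar) \<and> strict_antimono_on {\<mu>bar..} L"
proof -
  obtain \<delta> where \<delta>: "0 < \<delta>" "0 < L \<delta>" using L_increasing_near_0 by force
  obtain M0 where M0: "\<And>\<mu>. \<mu> \<ge> M0 \<Longrightarrow> L \<mu> < 0" using L_eventually_negative by blast
  define M where "M = max M0 \<delta>"
  have M: "0 < M" "\<delta> \<le> M" using \<delta> by (auto simp: M_def)
  obtain x0 where x0: "x0 \<in> {0..M}" "\<And>y. y \<in> {0..M} \<Longrightarrow> L y \<le> L x0"
    using continuous_attains_sup[OF compact_Icc _ L_continuous[OF M(1)]] M by auto
  have "L \<delta> \<le> L x0" using x0(2) \<delta> M by auto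
  have max: "L y \<le> L x0" if "0 \<le> y" for y
  proof (cases "y \<le> M")
    case False
    then have "L y < 0" by (intro M0) (auto simp: M_def)
    then show ?thesis using \<open>L \<delta> \<le> L x0\<close> \<delta> by simp
  qed (use that x0 in auto)
  define K where "K = {x \<in> {0..M}. L x = L x0}"
  have "closed K"
    unfolding K_def by (rule continuous_closed_preimage_constant[OF L_continuous[OF M(1)]]) simp
  moreover have "bounded K"
    by (rule bounded_subset[OF bounded_closed_interval[of 0 M]]) (auto simp: K_def)
  ultimately have "compact K" by (simp add: compact_eq_bounded_closed)
  moreover have "x0 \<in> K" using x0 by (simp add: K_def)
  ultimately obtain m where m: "m \<in> K" "\<And>x. x \<in> K \<Longrightarrow> x \<le> m"
    using compact_attains_sup[of K] by blast
  have m0: "0 \<le> m" "L m = L x0" using m by (auto simp: K_def)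
  have "m \<noteq> 0" using m0 \<open>L \<delta> \<le> L x0\<close> \<delta> L_0 by auto
  have less: "L x < L m" if "m < x" for x
  proof -
    have "L x \<noteq> L x0"
    proof
      assume eq: "L x = L x0"
      show False
      proof (cases "x \<le> M")
        case True
        then have "x \<in> K" using eq that m0 by (simp add: K_def)
        then show False using m(2) that by fastforce
      next
        case False
        then have "L x < 0" by (intro M0) (auto simp: M_def)
        then show False using eq \<open>L \<delta> \<le> L x0\<close> \<delta> by simp
      qed
    qed
    then show ?thesis using max[of x] that m0 by simp
  qed
  have "strict_antimono_on {m..} L"
  proof (rule monotone_onI)
    fix x y assume xy: "x \<in> {m..}" "y \<in> {m..}" "x < y"
    show "L y < L x"
    proof (cases "x = m")
      case True
      then show ?thesis using less xy by simp
    next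
      case False
      then have mx: "m < x" using xy by simp
      show ?thesis
      proof (rule ccontr)
        assume "\<not> L y < L x"
        have "(y - m) * L x = (y - x) * L x + (x - m) * L x" by (simp add: algebra_simps)
        also have "\<dots> < (y - x) * L m + (x - m) * L y"
          using \<open>\<not> L y < L x\<close> less[OF mx] mx xy
          by (intro add_less_le_mono mult_left_mono mult_strict_left_mono) auto
        also have "\<dots> \<le> (y - m) * L x"
          using mx xy m0 by (intro concave_on_chord[OF L_concave]) auto
        finally show False by simp
      qed
    qed
  qed
  then show ?thesis using m0 \<open>m \<noteq> 0\<close> max by (intro exI[of _ m]) auto
qed

end

section \<open>The ground state level\<close>

lemma energy_scale:
  assumes u: "u \<in> H1 (branches k)" and c: "0 < c"
  shows "energy p (branches k) (\<lambda>z. c * u z)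
    = c\<^sup>2 / 2 * dirichlet (branches k) u - c powr p / p * (LINT z|length_measure (branches k). \<bar>u z\<bar> powr p)"
  using c by (simp add: energy_def H1_scale(3)[OF countable_edges_branches u] abs_mult powr_mult)

lemma H1_mass_eq_image:
  assumes \<mu>: "0 < \<mu>"
  shows "H1_mass (branches k) \<mu> = (\<lambda>v z. sqrt \<mu> * v z) ` H1_mass (branches k) 1"
proof
  note scale = H1_scale[OF countable_edges_branches]
  show "(\<lambda>v z. sqrt \<mu> * v z) ` H1_mass (branches k) 1 \<subseteq> H1_mass (branches k) \<mu>"
    using scale(1,2) \<mu> by (auto simp: H1_mass_def)
  show "H1_mass (branches k) \<mu> \<subseteq> (\<lambda>v z. sqrt \<mu> * v z) ` H1_mass (branches k) 1"
  proof
    fix u assume u: "u \<in> H1_mass (branches k) \<mu>"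
    have "u = (\<lambda>z. sqrt \<mu> * (1 / sqrt \<mu> * u z))" using \<mu> by simp
    moreover have "(\<lambda>z. 1 / sqrt \<mu> * u z) \<in> H1_mass (branches k) 1"
      using u scale(1,2)[of u k "1 / sqrt \<mu>"] \<mu> by (simp add: H1_mass_def power_divide)
    ultimately show "u \<in> (\<lambda>v z. sqrt \<mu> * v z) ` H1_mass (branches k) 1"
      by (rule image_eqI[where f = "\<lambda>v z. sqrt \<mu> * v z" and x = "\<lambda>z. 1 / sqrt \<mu> * u z"])
  qed
qed

lemma H1_mass_nonempty:
  assumes "0 < k" "0 \<le> \<mu>" shows "H1_mass (branches k) \<mu> \<noteq> {}"
proof -
  obtain u z where u: "u \<in> H1 (branches k)" "z \<in> points (branches k)" "u z \<noteq> 0"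
    using exists_nonzero_H1[OF assms(1)] by blast
  define c where "c = sqrt (\<mu> / mass (branches k) u)"
  have "c\<^sup>2 * mass (branches k) u = \<mu>"
    using mass_pos[OF countable_edges_branches u] assms(2) by (simp add: c_def)
  then have "(\<lambda>z. c * u z) \<in> H1_mass (branches k) \<mu>"
    using H1_scale(1,2)[OF countable_edges_branches u(1), of c] by (simp add: H1_mass_def)
  then show ?thesis by blast
qed

text \<open>
  The normalisation to mass 1 breaks down at mass 0. A function of mass 0 vanishes on the graph, so
  only its Dirichlet integral is left of the energy.
\<close>

lemma energy_zero_mass_nonneg:
  assumes u: "u \<in> H1_mass (branches k) 0"
  shows "0 \<le> energy p (branches k) u"
proof -
  have "u z = 0" if "z \<in> points (branches k)" for z
    using mass_pos[OF countable_edges_branches _ that, of u] u by (auto simp: H1_mass_def)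
  then have "(LINT z|length_measure (branches k). \<bar>u z\<bar> powr p) = (LINT z|length_measure (branches k). 0)"
    by (intro Bochner_Integration.integral_cong) (auto simp: length_measure_def space_pair_measure points_def)
  then have "(LINT z|length_measure (branches k). \<bar>u z\<bar> powr p) = 0" by simp
  moreover have "0 \<le> dirichlet (branches k) u" by simp
  ultimately show ?thesis by (simp only: energy_def)
qed

lemma ground_level_zero_mass:
  assumes "0 < k"
  shows "ground_level p (branches k) 0 = 0"
proof -
  obtain v where v: "v \<in> H1_mass (branches k) 0" using H1_mass_nonempty[OF assms, of 0] by auto
  then have v1: "v \<in> H1 (branches k)" by (simp add: H1_mass_def)
  have "(\<lambda>z. 0 * v z) \<in> H1_mass (branches k) 0" "energy p (branches k) (\<lambda>z. 0 * v z) = 0"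
    using H1_scale[OF countable_edges_branches v1, of 0] by (simp_all add: H1_mass_def energy_def)
  then have "0 \<in> energy p (branches k) ` H1_mass (branches k) 0" by (metis image_eqI)
  then show ?thesis
    unfolding ground_level_def by (rule cInf_eq_minimum) (use energy_zero_mass_nonneg in auto)
qed

text \<open>
  The substitution \<open>u = sqrt \<mu> * v\<close> trades the mass constraint for the coefficients of the energy.
\<close>

lemma energy_image_eq:
  assumes \<mu>: "0 < \<mu>" and p: "0 < p"
  shows "energy p (branches k) ` H1_mass (branches k) \<mu> =
    (\<lambda>v. \<mu> / 2 * dirichlet (branches k) v - \<mu> powr (p / 2) * (1 / p * (LINT z|length_measure (branches k). \<bar>v z\<bar> powr p)))
      ` H1_mass (branches k) 1"
  unfolding H1_mass_eq_image[OF \<mu>] image_image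
proof (rule image_cong[OF refl])
  fix v assume "v \<in> H1_mass (branches k) 1"
  then have v: "v \<in> H1 (branches k)" by (simp add: H1_mass_def)
  have "sqrt \<mu> powr p = \<mu> powr (p / 2)"
    using \<mu> by (simp add: powr_half_sqrt[symmetric] powr_powr)
  then show "energy p (branches k) (\<lambda>z. sqrt \<mu> * v z) = \<mu> / 2 * dirichlet (branches k) v
      - \<mu> powr (p / 2) * (1 / p * (LINT z|length_measure (branches k). \<bar>v z\<bar> powr p))"
    using \<mu> by (simp add: energy_scale[OF v])
qed

text \<open>
  The Rayleigh quotient is invariant under scaling, so its infimum is approached by functions of mass 1.
\<close>

lemma nls_level_branches:
  assumes k: "0 < k" and p: "2 < p" "p < 6"
  shows "nls_level (H1_mass (branches k) 1) (dirichlet (branches k))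
    (\<lambda>v. 1 / p * (LINT z|length_measure (branches k). \<bar>v z\<bar> powr p)) (ground_level p (branches k))
    (rayleigh_inf (branches k)) (13 powr ((p - 2) / 2) / p) ((p - 2) / 4) (p / 2)"
proof
  let ?G = "branches k"
  let ?N = "\<lambda>v. 1 / p * (LINT z|length_measure ?G. \<bar>v z\<bar> powr p)"
  show S: "H1_mass ?G 1 \<noteq> {}" using H1_mass_nonempty[OF k, of 1] by simp
  show "0 < rayleigh_inf ?G" using rayleigh_inf_lower[OF k] by linarith
  show "rayleigh_inf ?G \<le> dirichlet ?G v" if "v \<in> H1_mass ?G 1" for v
    using rayleigh_inf_le[of v k] that by (simp add: H1_mass_def)
  show "\<exists>v\<in>H1_mass ?G 1. dirichlet ?G v < rayleigh_inf ?G + \<epsilon>" if "0 < \<epsilon>" for \<epsilon>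
  proof -
    let ?A = "{u \<in> H1 ?G. \<exists>z\<in>points ?G. u z \<noteq> 0}"
    have "Inf ((\<lambda>u. dirichlet ?G u / mass ?G u) ` ?A) < rayleigh_inf ?G + \<epsilon>"
      using that by (simp add: rayleigh_inf_def)
    moreover have "(\<lambda>u. dirichlet ?G u / mass ?G u) ` ?A \<noteq> {}" using exists_nonzero_H1[OF k] by blast
    ultimately have "\<exists>y\<in>(\<lambda>u. dirichlet ?G u / mass ?G u) ` ?A. y < rayleigh_inf ?G + \<epsilon>"
      by (intro cInf_lessD)
    then obtain u z where u1: "u \<in> H1 ?G" and z: "z \<in> points ?G" "u z \<noteq> 0"
      and less: "dirichlet ?G u / mass ?G u < rayleigh_inf ?G + \<epsilon>"
      by blast
    have m: "0 < mass ?G u" by (rule mass_pos[OF countable_edges_branches u1 z])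
    define c where "c = 1 / sqrt (mass ?G u)"
    have c: "c\<^sup>2 = 1 / mass ?G u" using m by (simp add: c_def power_divide)
    note scale = H1_scale[OF countable_edges_branches u1, of c]
    have "(\<lambda>z. c * u z) \<in> H1_mass ?G 1"
      using scale(1) m unfolding H1_mass_def mem_Collect_eq scale(2) c by simp
    moreover have "dirichlet ?G (\<lambda>z. c * u z) < rayleigh_inf ?G + \<epsilon>"
      unfolding scale(3) c using less by simp
    ultimately show ?thesis by blast
  qed
  show "0 < ?N v" if "v \<in> H1_mass ?G 1" for v
    using potential_bound(2)[of v k p] that p by (simp add: H1_mass_def)
  show "?N v \<le> 13 powr ((p - 2) / 2) / p * dirichlet ?G v powr ((p - 2) / 4)" if "v \<in> H1_mass ?G 1" for v
    using potential_bound(1)[of v k p] that p by (simp add: H1_mass_def divide_right_mono)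
  show "0 < 13 powr ((p - 2) / 2) / p" "0 < (p - 2) / 4" "(p - 2) / 4 < 1" "1 < p / 2"
    using p by auto
  show "ground_level p ?G \<mu> = (INF v\<in>H1_mass ?G 1. \<mu> / 2 * dirichlet ?G v - \<mu> powr (p / 2) * ?N v)" if "0 \<le> \<mu>" for \<mu>
  proof (cases "\<mu> = 0")
    case True
    then show ?thesis using ground_level_zero_mass[OF k] S by simp
  next
    case False
    then show ?thesis using that p energy_image_eq[of \<mu> p k] by (simp add: ground_level_def)
  qed
qed

theorem theorem1p1:
  fixes G :: btree and p :: real
  assumes "G = unrooted_binary_tree \<or> G = rooted_binary_tree"
    and "2 < p" and "p < 6"
  shows "(\<forall>\<mu>\<ge>0. H1_mass G \<mu> \<noteq> {} \<and> bdd_below (energy p G ` H1_mass G \<mu>)) \<and>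
    concave_on {0..} (ground_level p G) \<and>
    ground_level p G 0 = 0 \<and>
    (\<forall>\<mu>\<ge>0. ground_level p G \<mu> \<le> 1 / 2 * lambda1 * \<mu>) \<and>
    (ground_level p G has_real_derivative lambda1 / 2) (at_right 0) \<and>
    lambda1 / 2 > 0 \<and>
    (\<exists>\<delta>>0. (\<forall>\<mu>\<in>{0<..\<delta>}. ground_level p G \<mu> > 0) \<and> strict_mono_on {0..\<delta>} (ground_level p G)) \<and>
    (\<exists>\<mu>bar>0. (\<forall>\<mu>\<ge>0. ground_level p G \<mu> \<le> ground_level p G \<mu>bar) \<and>
       strict_antimono_on {\<mu>bar..} (ground_level p G)) \<and>
    (\<exists>M. \<forall>\<mu>\<ge>M. ground_level p G \<mu> < 0)"
proof -
  have "G = branches 3 \<or> G = branches 1"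
    using assms(1) by (simp add: unrooted_binary_tree_def rooted_binary_tree_def)
  then obtain k where k: "0 < k" and G: "G = branches k"
    using zero_less_one zero_less_numeral by metis
  have lam: "rayleigh_inf G = lambda1"
    using rayleigh_inf_branches[OF k] rayleigh_inf_branches[of 3]
    by (simp add: G lambda1_def unrooted_binary_tree_def)
  interpret nls_level "H1_mass G 1" "dirichlet G" "\<lambda>v. 1 / p * (LINT z|length_measure G. \<bar>v z\<bar> powr p)"
    "ground_level p G" lambda1 "13 powr ((p - 2) / 2) / p" "(p - 2) / 4" "p / 2"
    using nls_level_branches[OF k assms(2,3)] unfolding G[symmetric] lam .
  have "H1_mass G \<mu> \<noteq> {} \<and> bdd_below (energy p G ` H1_mass G \<mu>)" if "0 \<le> \<mu>" for \<mu>
  proof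
    show "H1_mass G \<mu> \<noteq> {}" unfolding G by (rule H1_mass_nonempty[OF k that])
    show "bdd_below (energy p G ` H1_mass G \<mu>)"
    proof (cases "\<mu> = 0")
      case True
      then show ?thesis using energy_zero_mass_nonneg unfolding G by (intro bdd_belowI[of _ 0]) auto
    next
      case False
      then show ?thesis
        using bdd_below_energy[OF that] energy_image_eq[of \<mu> p k] that assms(2) by (simp add: G)
    qed
  qed
  then show ?thesis
    using L_concave L_0 L_le_linear L_deriv lam_pos L_increasing_near_0 L_maximum L_eventually_negative
    by (intro conjI allI impI) auto
qed

end
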